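(* Let a quantum particle in $d$-dimensional continuous space have Hilbert space $\mathcal{H}_C\otimes L^2(\mathbb{R}^d)$ with $\mathcal{H}_C$ finite-dimensional, and Hamiltonian $H=\sum_{l=1}^{n}H_l$, where each $H_l$ is self-adjoint and is either linear in a component of the momentum vector operator (i.e. $H_l=B_l\otimes P_b$ for some $b\in\{1,\dots,d\}$ and some self-adjoint operator $B_l$ on $\mathcal{H}_C$) or constant (i.e. $H_l=B_l\otimes\mathbb{I}$ with $B_l$ a self-adjoint operator on $\mathcal{H}_C$). For $a>0$ define $$V=\left(e^{-iH_1a}\cdots e^{-iH_na}\right)\left(e^{-iH_na}\cdots e^{-iH_1a}\right).$$ Then $V$ converges to evolution via $H$ with error $O(\Lambda^3a^2)$, in the sense that $$\left\|V^{N/2}-e^{-iHt}\right\|_{\Lambda}=O(\Lambda^3a^2),$$ where $t=Na$ and $\Lambda$ is the momentum cutoff.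
   Context: $P_b=-i\partial_{x_b}$ are the components of the momentum operator ($\hbar=1$). $\|\cdot\|_{\Lambda}$ is the operator norm restricted to the subspace of states whose momentum components all satisfy $|p_b|\le\Lambda$. The $O(\cdot)$ refers to the limit $a\to0$ with the total time $t=Na$ fixed and $N$ an even integer, where the cutoff $\Lambda=\Lambda(a)$ tends to infinity as $a\to0$: there is a constant $C$ (depending on $t$ and the $H_l$ but not on $a$ or $\Lambda$) with the left-hand side at most $C\Lambda^3a^2$ for all sufficiently small $a$. *)

theory Defs
  imports "HOL-Analysis.Analysis"
begin

section \<open>The Hilbert space\<close>

text \<open>
  The internal space is the finite-dimensional Hilbert space \<open>complex ^ 'c\<close>, position space is
  \<open>real ^ 'd\<close>, and the tensor product of the internal space with the square-integrable complex
  functions is realised as the space of square-integrable functions with values in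
  \<open>complex ^ 'c\<close>, modulo equality almost everywhere.
\<close>

definition square_integrable :: "('a::euclidean_space \<Rightarrow> 'b::euclidean_space) \<Rightarrow> bool" where
  "square_integrable f \<longleftrightarrow>
     f \<in> borel_measurable lborel \<and> integrable lborel (\<lambda>x. (norm (f x))\<^sup>2)"

lemma square_integrable_bounded:
  assumes "square_integrable f" "g \<in> borel_measurable lborel"
    and "\<And>x. norm (g x) \<le> K * norm (f x)"
  shows "square_integrable g"
proof -
  have "integrable lborel (\<lambda>x. K\<^sup>2 * (norm (f x))\<^sup>2)"
    using assms(1) unfolding square_integrable_def by simp
  then have "integrable lborel (\<lambda>x. (norm (g x))\<^sup>2)"
  proof (rule Bochner_Integration.integrable_bound)
    show "(\<lambda>x. (norm (g x))\<^sup>2) \<in> borel_measurable lborel"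
      using assms(2) by measurable
    have "(norm (g x))\<^sup>2 \<le> K\<^sup>2 * (norm (f x))\<^sup>2" for x
      using power_mono[OF assms(3)[of x], of 2] by (simp add: power_mult_distrib)
    then show "AE x in lborel. norm ((norm (g x))\<^sup>2) \<le> norm (K\<^sup>2 * (norm (f x))\<^sup>2)"
      by simp
  qed
  with assms(2) show ?thesis by (simp add: square_integrable_def)
qed

lemma square_integrable_linear:
  assumes "square_integrable f" "bounded_linear T"
  shows "square_integrable (\<lambda>x. T (f x))"
proof -
  obtain K where K: "\<And>x. norm (T x) \<le> norm x * K"
    using bounded_linear.bounded[OF assms(2)] by blast
  have "(\<lambda>x. T (f x)) \<in> borel_measurable lborel"
    using assms unfolding square_integrable_def
    by (auto intro: borel_measurable_continuous_on linear_continuous_on)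
  with assms(1) show ?thesis
    by (rule square_integrable_bounded[where K = K]) (use K in \<open>simp add: mult.commute\<close>)
qed

lemma square_integrable_add:
  assumes "square_integrable f" "square_integrable g"
  shows "square_integrable (\<lambda>x. f x + g x)"
proof -
  have m: "(\<lambda>x. f x + g x) \<in> borel_measurable lborel"
    using assms unfolding square_integrable_def by auto
  have "integrable lborel (\<lambda>x. 2 * (norm (f x))\<^sup>2 + 2 * (norm (g x))\<^sup>2)"
    using assms unfolding square_integrable_def by auto
  then have "integrable lborel (\<lambda>x. (norm (f x + g x))\<^sup>2)"
  proof (rule Bochner_Integration.integrable_bound)
    show "(\<lambda>x. (norm (f x + g x))\<^sup>2) \<in> borel_measurable lborel"
      using m by measurable
    have "(norm (f x + g x))\<^sup>2 \<le> 2 * (norm (f x))\<^sup>2 + 2 * (norm (g x))\<^sup>2" for x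
    proof -
      have "(norm (f x + g x))\<^sup>2 \<le> (norm (f x) + norm (g x))\<^sup>2"
        by (intro power_mono norm_triangle_ineq) auto
      also have "\<dots> \<le> 2 * (norm (f x))\<^sup>2 + 2 * (norm (g x))\<^sup>2"
        using sum_squares_bound[of "norm (f x)" "norm (g x)"]
        by (simp add: power2_eq_square algebra_simps)
      finally show ?thesis .
    qed
    then show "AE x in lborel. norm ((norm (f x + g x))\<^sup>2)
        \<le> norm (2 * (norm (f x))\<^sup>2 + 2 * (norm (g x))\<^sup>2)"
      by simp
  qed
  with m show ?thesis by (simp add: square_integrable_def)
qed

lemma square_integrable_zero: "square_integrable (\<lambda>x. 0)"
  by (simp add: square_integrable_def)

lemma square_integrable_minus: "square_integrable f \<Longrightarrow> square_integrable (\<lambda>x. - f x)"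
  by (erule square_integrable_linear[of f uminus]) (intro bounded_linear_minus bounded_linear_ident)

lemma square_integrable_scaleR: "square_integrable f \<Longrightarrow> square_integrable (\<lambda>x. r *\<^sub>R f x)"
  by (erule square_integrable_linear) (rule bounded_linear_scaleR_right)

lemma square_integrable_diff:
  "square_integrable f \<Longrightarrow> square_integrable g \<Longrightarrow> square_integrable (\<lambda>x. f x - g x)"
  using square_integrable_add[of f "\<lambda>x. - g x"] square_integrable_minus[of g] by simp

lemma square_integrable_inner:
  assumes "square_integrable f" "square_integrable g"
  shows "integrable lborel (\<lambda>x. f x \<bullet> g x)"
proof -
  have "integrable lborel (\<lambda>x. (norm (f x))\<^sup>2 + (norm (g x))\<^sup>2)"
    using assms unfolding square_integrable_def by auto
  then show ?thesis
  proof (rule Bochner_Integration.integrable_bound)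
    show "(\<lambda>x. f x \<bullet> g x) \<in> borel_measurable lborel"
      using assms unfolding square_integrable_def by auto
    have "\<bar>f x \<bullet> g x\<bar> \<le> (norm (f x))\<^sup>2 + (norm (g x))\<^sup>2" for x
    proof -
      have "\<bar>f x \<bullet> g x\<bar> \<le> norm (f x) * norm (g x)"
        by (rule Cauchy_Schwarz_ineq2)
      moreover have "0 \<le> norm (f x) * norm (g x)" by simp
      ultimately show ?thesis
        using sum_squares_bound[of "norm (f x)" "norm (g x)"] by simp
    qed
    then show "AE x in lborel. norm (f x \<bullet> g x) \<le> norm ((norm (f x))\<^sup>2 + (norm (g x))\<^sup>2)"
      by simp
  qed
qed

lemma square_integrable_translate:
  fixes h :: "'a::euclidean_space"
  assumes "square_integrable f"
  shows "square_integrable (\<lambda>x. f (x + h))"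
proof -
  have m: "f \<in> borel_measurable borel" and i: "integrable lborel (\<lambda>x. (norm (f x))\<^sup>2)"
    using assms unfolding square_integrable_def by auto
  have "integrable (distr lborel borel ((+) h)) (\<lambda>x. (norm (f x))\<^sup>2)"
    using i by (simp add: lborel_distr_plus)
  then have "integrable lborel (\<lambda>x. (norm (f (h + x)))\<^sup>2)"
    using m by (subst (asm) integrable_distr_eq) auto
  moreover have "(\<lambda>x. f (x + h)) \<in> borel_measurable lborel"
    using m by simp
  ultimately show ?thesis
    by (simp add: square_integrable_def add.commute)
qed

lemma AE_lborel_translate:
  fixes h :: "'a::euclidean_space"
  assumes "AE x in lborel. P x"
  shows "AE x in lborel. P (x + h)"
proof -
  have "AE x in distr lborel borel ((+) h). P x"
    unfolding lborel_distr_plus by (fact assms)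
  then have "AE x in lborel. P (h + x)"
    by (intro AE_distrD[of "(+) h" lborel borel]) simp_all
  then show ?thesis by (simp add: add.commute)
qed

definition l2_rel :: "(real ^ 'd \<Rightarrow> complex ^ 'c) \<Rightarrow> (real ^ 'd \<Rightarrow> complex ^ 'c) \<Rightarrow> bool" where
  "l2_rel f g \<longleftrightarrow>
     square_integrable f \<and> square_integrable g \<and> (AE x in lborel. f x = g x)"

quotient_type (overloaded) ('d, 'c) l2 =
  "real ^ 'd::finite \<Rightarrow> complex ^ 'c::finite" / partial: l2_rel
proof (rule part_equivpI)
  show "\<exists>f. l2_rel f f"
    by (rule exI[of _ "\<lambda>_. 0"]) (simp add: l2_rel_def square_integrable_zero)
  show "symp l2_rel"
    by (auto intro!: sympI simp: l2_rel_def elim: eventually_mono)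
  show "transp l2_rel"
    by (auto intro!: transpI simp: l2_rel_def elim: eventually_elim2)
qed

instantiation l2 :: (finite, finite) real_inner
begin

lift_definition zero_l2 :: "('a, 'b) l2" is "\<lambda>_. 0"
  by (simp add: l2_rel_def square_integrable_zero)

lift_definition plus_l2 :: "('a, 'b) l2 \<Rightarrow> ('a, 'b) l2 \<Rightarrow> ('a, 'b) l2" is "\<lambda>f g x. f x + g x"
  by (auto simp: l2_rel_def square_integrable_add elim: eventually_elim2)

lift_definition uminus_l2 :: "('a, 'b) l2 \<Rightarrow> ('a, 'b) l2" is "\<lambda>f x. - f x"
  by (auto simp: l2_rel_def square_integrable_minus elim: eventually_mono)

lift_definition minus_l2 :: "('a, 'b) l2 \<Rightarrow> ('a, 'b) l2 \<Rightarrow> ('a, 'b) l2" is "\<lambda>f g x. f x - g x"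
  by (auto simp: l2_rel_def square_integrable_diff elim: eventually_elim2)

lift_definition scaleR_l2 :: "real \<Rightarrow> ('a, 'b) l2 \<Rightarrow> ('a, 'b) l2" is "\<lambda>r f x. r *\<^sub>R f x"
  by (auto simp: l2_rel_def square_integrable_scaleR elim: eventually_mono)

text \<open>Real part of the complex inner product; it induces the same norm.\<close>

lift_definition inner_l2 :: "('a, 'b) l2 \<Rightarrow> ('a, 'b) l2 \<Rightarrow> real"
  is "\<lambda>f g. integral\<^sup>L lborel (\<lambda>x. f x \<bullet> g x)"
proof -
  fix f f' g g' :: "real ^ 'a \<Rightarrow> complex ^ 'b"
  assume "l2_rel f f'" "l2_rel g g'"
  then have "square_integrable f" "square_integrable f'" "square_integrable g"
      "square_integrable g'" and "AE x in lborel. f x = f' x" "AE x in lborel. g x = g' x"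
    by (auto simp: l2_rel_def)
  then show "integral\<^sup>L lborel (\<lambda>x. f x \<bullet> g x) = integral\<^sup>L lborel (\<lambda>x. f' x \<bullet> g' x)"
    by (intro integral_cong_AE)
      (rule borel_measurable_integrable, rule square_integrable_inner, assumption, assumption,
        rule borel_measurable_integrable, rule square_integrable_inner, assumption, assumption,
        erule eventually_elim2, assumption, simp)
qed

definition norm_l2 :: "('a, 'b) l2 \<Rightarrow> real" where
  "norm_l2 \<psi> = sqrt (inner \<psi> \<psi>)"

definition sgn_l2 :: "('a, 'b) l2 \<Rightarrow> ('a, 'b) l2" where
  "sgn_l2 \<psi> = inverse (norm \<psi>) *\<^sub>R \<psi>"

definition dist_l2 :: "('a, 'b) l2 \<Rightarrow> ('a, 'b) l2 \<Rightarrow> real" where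
  "dist_l2 \<psi> \<phi> = norm (\<psi> - \<phi>)"

definition uniformity_l2 :: "(('a, 'b) l2 \<times> ('a, 'b) l2) filter" where
  "uniformity_l2 = (INF e\<in>{0<..}. principal {(x, y). dist x y < e})"

definition open_l2 :: "('a, 'b) l2 set \<Rightarrow> bool" where
  "open_l2 U \<longleftrightarrow> (\<forall>x\<in>U. eventually (\<lambda>(x', y). x' = x \<longrightarrow> y \<in> U) uniformity)"

instance
proof
  fix a b c :: "('a, 'b) l2" and r s :: real
  show "a + b + c = a + (b + c)"
    by transfer (auto simp: l2_rel_def square_integrable_add algebra_simps)
  show "a + b = b + a"
    by transfer (auto simp: l2_rel_def square_integrable_add algebra_simps)
  show "0 + a = a"
    by transfer (auto simp: l2_rel_def)
  show "- a + a = 0"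
    by transfer (auto simp: l2_rel_def square_integrable_zero)
  show "a - b = a + - b"
    by transfer (auto simp: l2_rel_def square_integrable_diff)
  show "r *\<^sub>R (a + b) = r *\<^sub>R a + r *\<^sub>R b"
    by transfer (auto simp: l2_rel_def algebra_simps
        intro!: square_integrable_add square_integrable_scaleR)
  show "(r + s) *\<^sub>R a = r *\<^sub>R a + s *\<^sub>R a"
    by transfer (auto simp: l2_rel_def algebra_simps
        intro!: square_integrable_add square_integrable_scaleR)
  show "r *\<^sub>R s *\<^sub>R a = (r * s) *\<^sub>R a"
    by transfer (auto simp: l2_rel_def
        intro!: square_integrable_scaleR)
  show "1 *\<^sub>R a = a"
    by transfer (auto simp: l2_rel_def)
  show "dist a b = norm (a - b)" by (rule dist_l2_def)
  show "sgn a = inverse (norm a) *\<^sub>R a" by (rule sgn_l2_def)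
  show "inner a b = inner b a"
    by transfer (simp add: inner_commute)
  show "inner (a + b) c = inner a c + inner b c"
    by transfer (simp add: l2_rel_def inner_add_left square_integrable_inner)
  show "inner (r *\<^sub>R a) b = r * inner a b"
    by transfer simp
  show "0 \<le> inner a a"
    by transfer simp
  show "inner a a = 0 \<longleftrightarrow> a = 0"
  proof transfer
    fix f :: "real ^ 'a \<Rightarrow> complex ^ 'b"
    assume "l2_rel f f"
    then have f: "square_integrable f" by (simp add: l2_rel_def)
    have "integral\<^sup>L lborel (\<lambda>x. f x \<bullet> f x) = 0 \<longleftrightarrow> (AE x in lborel. f x \<bullet> f x = 0)"
      by (rule integral_nonneg_eq_0_iff_AE) (simp_all add: square_integrable_inner f)
    also have "\<dots> \<longleftrightarrow> l2_rel f (\<lambda>_. 0)"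
      by (simp add: l2_rel_def f square_integrable_zero)
    finally show "integral\<^sup>L lborel (\<lambda>x. f x \<bullet> f x) = 0 \<longleftrightarrow> l2_rel f (\<lambda>_. 0)" .
  qed
  show "norm a = sqrt (inner a a)" by (rule norm_l2_def)
  show "uniformity = (INF e\<in>{0<..}. principal {(x :: ('a, 'b) l2, y). dist x y < e})"
    by (rule uniformity_l2_def)
  show "open U \<longleftrightarrow> (\<forall>x\<in>U. eventually (\<lambda>(x', y). x' = x \<longrightarrow> y \<in> U) uniformity)"
    for U :: "('a, 'b) l2 set"
    by (simp add: open_l2_def)
qed

end

lemma bounded_linear_vec_complex_scale:
  "bounded_linear (\<lambda>v :: complex ^ 'c. c *s v)"
  by (rule linear_conv_bounded_linear[THEN iffD1], rule linearI)
    (auto simp: vec_eq_iff algebra_simps)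

lemma bounded_linear_complex_matrix:
  "bounded_linear (\<lambda>v :: complex ^ 'c. B *v v :: complex ^ 'c)"
  by (rule linear_conv_bounded_linear[THEN iffD1], rule linearI)
    (auto simp: vec_eq_iff matrix_vector_mult_def sum.distrib algebra_simps scaleR_sum_right)

lemma square_integrable_vec_complex_scale:
  fixes f :: "'a::euclidean_space \<Rightarrow> complex ^ 'c"
  shows "square_integrable f \<Longrightarrow> square_integrable (\<lambda>x. c *s f x)"
  by (erule square_integrable_linear) (rule bounded_linear_vec_complex_scale)

lemma square_integrable_complex_matrix:
  fixes f :: "'a::euclidean_space \<Rightarrow> complex ^ 'c" and B :: "complex ^ 'c ^ 'c"
  shows "square_integrable f \<Longrightarrow> square_integrable (\<lambda>x. B *v f x)"
  by (erule square_integrable_linear) (rule bounded_linear_complex_matrix)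

lift_definition cscale :: "complex \<Rightarrow> ('d::finite, 'c::finite) l2 \<Rightarrow> ('d, 'c) l2"
  (infixr "*\<^sub>C" 75) is "\<lambda>c f x. c *s f x"
  by (auto simp: l2_rel_def intro!: square_integrable_vec_complex_scale
      elim: eventually_mono)

text \<open>The action of an operator on the internal space, i.e. \<open>B \<otimes> I\<close>.\<close>

lift_definition internal :: "complex ^ 'c ^ 'c \<Rightarrow> ('d::finite, 'c::finite) l2 \<Rightarrow> ('d, 'c) l2"
  is "\<lambda>B f x. B *v f x"
  by (auto simp: l2_rel_def intro!: square_integrable_complex_matrix
      elim: eventually_mono)

lift_definition translate :: "real ^ 'd \<Rightarrow> ('d::finite, 'c::finite) l2 \<Rightarrow> ('d, 'c) l2"
  is "\<lambda>h f x. f (x + h)"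
  unfolding l2_rel_def
  by (elim conjE, intro conjI square_integrable_translate, assumption, assumption,
      erule AE_lborel_translate)

section \<open>Unbounded operators\<close>

text \<open>A (partially defined) operator is given by its graph.\<close>

type_synonym ('d, 'c) operator = "(('d, 'c) l2 \<times> ('d, 'c) l2) set"

text \<open>
  The partial derivative in \<open>P\<^sub>b = - \<i> \<partial>\<^sub>b\<close> is the limit, in the norm of the Hilbert space, of the
  difference quotients \<open>(\<psi> (x + h e\<^sub>b) - \<psi> x) / h\<close>; the domain consists of all \<open>\<psi>\<close> for which this
  limit exists. This is the self-adjoint momentum operator.
\<close>

definition momentum :: "'d::finite \<Rightarrow> ('d, 'c::finite) operator" where
  "momentum b = {(\<psi>, - \<i> *\<^sub>C \<eta>) | \<psi> \<eta>.
     ((\<lambda>h. translate (h *\<^sub>R axis b 1) \<psi>) has_vector_derivative \<eta>) (at 0)}"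

text \<open>
  \<open>B \<otimes> P\<^sub>b\<close> on its self-adjointness domain, which for singular \<open>B\<close> is larger than the domain
  of \<open>P\<^sub>b\<close>.
\<close>

definition linear_term :: "complex ^ 'c ^ 'c \<Rightarrow> 'd::finite \<Rightarrow> ('d, 'c::finite) operator" where
  "linear_term B b = {(\<psi>, \<phi>). (internal B \<psi>, \<phi>) \<in> momentum b}"

definition constant_term :: "complex ^ 'c ^ 'c \<Rightarrow> ('d::finite, 'c::finite) operator" where
  "constant_term B = {(\<psi>, internal B \<psi>) | \<psi>. True}"

definition hermitian :: "complex ^ 'c ^ 'c \<Rightarrow> bool" where
  "hermitian B \<longleftrightarrow> (\<forall>i j. B $ i $ j = cnj (B $ j $ i))"

text \<open>The sum of operators, defined on the intersection of the domains.\<close>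

definition operator_sum :: "'i set \<Rightarrow> ('i \<Rightarrow> ('d::finite, 'c::finite) operator) \<Rightarrow> ('d, 'c) operator"
  where "operator_sum I A = {(\<psi>, \<Sum>i\<in>I. \<phi> i) | \<psi> \<phi>. \<forall>i\<in>I. (\<psi>, \<phi> i) \<in> A i}"

text \<open>
  The unitary \<open>e\<^sup>-\<^sup>i\<^sup>A\<^sup>t\<close> generated by \<open>A\<close> is the propagator of the Schroedinger equation
  \<open>u' = - \<i> A u\<close>: it maps \<open>u 0\<close> to \<open>u t\<close> for every strong solution \<open>u\<close>, and is extended from the
  dense set of initial values of such solutions to the whole Hilbert space by continuity, i.e.
  by taking the closure of the graph. For self-adjoint \<open>A\<close> the initial values are the
  vectors in the domain of \<open>A\<close>, and the propagator is the unitary group of Stone's theorem.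
  A sum of terms as above need not be closed on the intersection of the domains, but
  it is essentially self-adjoint there, and has strong solutions for a dense set of initial values;
  the propagator is then that of its self-adjoint closure.
\<close>

definition schroedinger_solution ::
    "('d::finite, 'c::finite) operator \<Rightarrow> (real \<Rightarrow> ('d, 'c) l2) \<Rightarrow> bool" where
  "schroedinger_solution A u \<longleftrightarrow>
     (\<forall>s. \<exists>\<phi>. (u s, \<phi>) \<in> A \<and> (u has_vector_derivative (- \<i> *\<^sub>C \<phi>)) (at s))"

definition evolution :: "('d::finite, 'c::finite) operator \<Rightarrow> real \<Rightarrow> ('d, 'c) l2 \<Rightarrow> ('d, 'c) l2"
  where "evolution A t \<psi> =
    (THE \<phi>. (\<psi>, \<phi>) \<in> closure {(u 0, u t) | u. schroedinger_solution A u})"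

section \<open>The product formula and the momentum cutoff\<close>

text \<open>
  \<open>V = (e\<^sup>-\<^sup>i\<^sup>H\<^sup>1\<^sup>a \<cdots> e\<^sup>-\<^sup>i\<^sup>H\<^sup>n\<^sup>a) (e\<^sup>-\<^sup>i\<^sup>H\<^sup>n\<^sup>a \<cdots> e\<^sup>-\<^sup>i\<^sup>H\<^sup>1\<^sup>a)\<close>
\<close>

definition trotter_step ::
    "nat \<Rightarrow> (nat \<Rightarrow> ('d::finite, 'c::finite) operator) \<Rightarrow> real \<Rightarrow> ('d, 'c) l2 \<Rightarrow> ('d, 'c) l2" where
  "trotter_step n H a =
     foldr (\<circ>) (map (\<lambda>l. evolution (H l) a) [1..<Suc n]) id \<circ>
     foldr (\<circ>) (map (\<lambda>l. evolution (H l) a) (rev [1..<Suc n])) id"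

text \<open>
  The states all of whose momentum components are at most \<open>\<Lambda>\<close> in absolute value: the inverse Fourier
  transforms of square-integrable \<open>g\<close> vanishing outside the corresponding cube. Such \<open>g\<close> are
  integrable, so the Fourier integral converges absolutely.
\<close>

definition cutoff_states :: "real \<Rightarrow> ('d::finite, 'c::finite) l2 set" where
  "cutoff_states \<Lambda> = {\<psi>. \<exists>g :: real ^ 'd \<Rightarrow> complex ^ 'c.
     square_integrable g \<and> (\<forall>p. (\<exists>b. \<bar>p $ b\<bar> > \<Lambda>) \<longrightarrow> g p = 0) \<and>
     (AE x in lborel. rep_l2 \<psi> x =
        (1 / sqrt ((2 * pi) ^ CARD('d))) *\<^sub>R
          integral\<^sup>L lborel (\<lambda>p. exp (\<i> * of_real (p \<bullet> x)) *s g p))}"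

definition cutoff_norm ::
    "real \<Rightarrow> (('d::finite, 'c::finite) l2 \<Rightarrow> ('d, 'c) l2) \<Rightarrow> ereal" where
  "cutoff_norm \<Lambda> T = (SUP \<psi>\<in>{\<psi>\<in>cutoff_states \<Lambda>. norm \<psi> \<le> 1}. ereal (norm (T \<psi>)))"

end

theory Submission
  imports Defs "HOL-Probability.Characteristic_Functions"
begin

text \<open>
  On states with momenta in the cube of side \<open>2\<Lambda>\<close> every \<open>H\<^sub>l\<close> and every partial sum of them acts as a
  bounded operator of norm \<open>O(\<Lambda>)\<close>: it multiplies the Fourier transform by a Hermitian matrix \<open>S(p)\<close>
  affine in \<open>p\<close>, and \<open>e\<^sup>-\<^sup>i\<^sup>A\<^sup>s\<close> multiplies it by the exponential series of \<open>- \<i> s S(p)\<close>, so the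
  cutoff states are invariant. Only the inequality \<open>\<parallel>F\<^sup>-\<^sup>1 g\<parallel> \<le> \<parallel>g\<parallel>\<close> is needed, not Plancherel's
  theorem: the operator norm bound follows from the log-convexity of \<open>k \<mapsto> \<parallel>A\<^sup>k \<psi>\<parallel>\<close> for symmetric \<open>A\<close>.
  By third order Taylor expansion, \<open>e\<^sup>P e\<^sup>2\<^sup>Q e\<^sup>P\<close> and \<open>e\<^sup>2\<^sup>(\<^sup>P\<^sup>+\<^sup>Q\<^sup>)\<close> differ by a constant times
  the cube of the norms of \<open>P\<close> and \<open>Q\<close>. Since all propagators are isometries, peeling off the factors of \<open>V\<close> from
  the outside gives an error \<open>O((\<Lambda> a)\<^sup>3)\<close> per step, and \<open>t / (2a)\<close> steps add up to
  \<open>O(\<Lambda>\<^sup>3 a\<^sup>2)\<close>.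
\<close>

section \<open>Isometric flows with bounded generator\<close>

text \<open>Two obstacles shape the construction. The propagators are closures of graphs attached to
  unbounded operators, so there is no functional calculus to read their values from; on cutoff
  states these values are found by exhibiting an explicit strong solution, and symmetry of the
  operator makes it the only one. Moreover the Hilbert space is used without completeness, so no
  exponential series is summed in it: the series are summed at each momentum separately, in the
  finite-dimensional internal space, and the result is carried over by the Fourier integral. This is
  why an abstract notion of isometric flow is set up first: it serves both for matrices at a fixed
  momentum and for the propagators on the cutoff states. The assumption
  \<open>1 \<le> \<Lambda>\<close> lets constant terms share the bound
  \<open>\<beta> * \<Lambda>\<close> of the linear ones, so that a single homogeneous cubic estimate
  suffices. The inner factor is doubled in the splitting because each inner block of
  \<open>V\<close> is compared with the remaining terms at time \<open>2 * a\<close>.\<close>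

lemma norm_constant_if_derivative_orthogonal:
  fixes w :: "real \<Rightarrow> 'a::real_inner"
  assumes "\<And>s. (w has_vector_derivative w' s) (at s)" "\<And>s. w' s \<bullet> w s = 0"
  shows "norm (w s) = norm (w 0)"
proof -
  have "((\<lambda>s. w s \<bullet> w s) has_derivative (\<lambda>h. 0)) (at s)" for s
  proof -
    have "((\<lambda>s. w s \<bullet> w s) has_derivative (\<lambda>h. w s \<bullet> (h *\<^sub>R w' s) + (h *\<^sub>R w' s) \<bullet> w s)) (at s)"
      using assms(1)[of s] unfolding has_vector_derivative_def
      by (rule has_derivative_inner) (use assms(1)[of s] in \<open>simp add: has_vector_derivative_def\<close>)
    then show ?thesis
      using assms(2)[of s] by (simp add: inner_commute)
  qed
  then have "w s \<bullet> w s = w 0 \<bullet> w 0"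
    using has_derivative_zero_constant[of UNIV "\<lambda>s. w s \<bullet> w s"] by auto
  then show ?thesis
    by (simp add: norm_eq_sqrt_inner)
qed

text \<open>A mean value inequality with a monomial majorant. Each application raises the order of a
  remainder by one, which replaces the integral form of Taylor's theorem and so needs no integration
  of vector-valued functions.\<close>

lemma norm_le_power_if_derivative_le_power:
  fixes f :: "real \<Rightarrow> 'a::real_normed_vector"
  assumes "\<And>s. 0 \<le> s \<Longrightarrow> (f has_vector_derivative f' s) (at s)"
    and "\<And>s. 0 \<le> s \<Longrightarrow> norm (f' s) \<le> C * s ^ k" and "f 0 = 0" and "0 \<le> s"
  shows "norm (f s) \<le> C * s ^ Suc k / Suc k"
proof (cases "s = 0")
  case False
  then have "0 < s" using assms(4) by simp
  have d: "((\<lambda>s. C * s ^ Suc k / Suc k) has_vector_derivative C * x ^ k) (at x)" for x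
    unfolding has_real_derivative_iff_has_vector_derivative[symmetric]
    by (rule DERIV_cong[OF DERIV_cdivide[OF DERIV_cmult[OF DERIV_pow]]]) simp
  have "norm (f s - f 0) \<le> C * s ^ Suc k / Suc k - C * 0 ^ Suc k / Suc k"
  proof (rule differentiable_bound_general[OF \<open>0 < s\<close>, where f' = f'])
    show "continuous_on {0..s} f"
      by (intro continuous_at_imp_continuous_on ballI)
        (auto intro: has_vector_derivative_continuous assms(1))
    show "continuous_on {0..s} (\<lambda>s. C * s ^ Suc k / Suc k)"
      by (intro continuous_intros) auto
  qed (use assms d in auto)
  then show ?thesis using assms(3) by simp
qed (use assms in simp)

text \<open>\<open>Z\<close> and \<open>U\<close> are total functions constrained only on the
  subspace \<open>K\<close>, because the generator of an unbounded operator is meaningful only on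
  its domain. The inner product is real, so \<open>gen_skew\<close> is exactly what makes norms
  constant along solutions. The instances are \<open>K = UNIV\<close> for matrices at one momentum
  and \<open>K = cutoff_states \<Lambda>\<close> for the propagators.\<close>

locale bounded_flow =
  fixes K :: "'a::real_inner set" and Z :: "'a \<Rightarrow> 'a" and U :: "real \<Rightarrow> 'a \<Rightarrow> 'a" and M :: real
  assumes subspace: "subspace K"
    and gen_in: "x \<in> K \<Longrightarrow> Z x \<in> K"
    and gen_add: "x \<in> K \<Longrightarrow> y \<in> K \<Longrightarrow> Z (x + y) = Z x + Z y"
    and gen_scale: "x \<in> K \<Longrightarrow> Z (r *\<^sub>R x) = r *\<^sub>R Z x"
    and gen_bound: "x \<in> K \<Longrightarrow> norm (Z x) \<le> M * norm x"
    and gen_skew: "x \<in> K \<Longrightarrow> Z x \<bullet> x = 0"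
    and flow_in: "x \<in> K \<Longrightarrow> U s x \<in> K"
    and flow_0: "x \<in> K \<Longrightarrow> U 0 x = x"
    and flow_deriv: "x \<in> K \<Longrightarrow> ((\<lambda>s. U s x) has_vector_derivative Z (U s x)) (at s)"
    and bound_nonneg: "0 \<le> M"
begin

lemmas space_closed =
  subspace_add[OF subspace] subspace_diff[OF subspace] subspace_scale[OF subspace]

lemma gen_diff: "x \<in> K \<Longrightarrow> y \<in> K \<Longrightarrow> Z (x - y) = Z x - Z y"
  using gen_add[of x "(-1) *\<^sub>R y"] gen_scale[of y "-1"] space_closed(3)[of y "-1"] by simp

text \<open>The difference of two solutions has a derivative orthogonal to itself, hence constant
  norm. Additivity, homogeneity and the group law of the flow below all follow by recognising both
  sides as solutions with the same initial value.\<close>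

lemma solution_unique:
  assumes "\<And>s. u s \<in> K" "\<And>s. v s \<in> K"
    and "\<And>s. (u has_vector_derivative Z (u s)) (at s)"
    and "\<And>s. (v has_vector_derivative Z (v s)) (at s)"
    and "u 0 = v 0"
  shows "u s = v s"
proof -
  have "norm (u s - v s) = norm (u 0 - v 0)"
  proof (rule norm_constant_if_derivative_orthogonal[where w = "\<lambda>s. u s - v s"])
    show "((\<lambda>s. u s - v s) has_vector_derivative (Z (u s - v s))) (at s)" for s
      using assms by (auto simp: gen_diff intro!: derivative_eq_intros)
    show "Z (u s - v s) \<bullet> (u s - v s) = 0" for s
      using assms by (intro gen_skew space_closed)
  qed
  with assms(5) show ?thesis by simp
qed

lemma norm_flow: "x \<in> K \<Longrightarrow> norm (U s x) = norm x"
  using norm_constant_if_derivative_orthogonal[of "\<lambda>s. U s x", OF flow_deriv gen_skew]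
  by (simp add: flow_0 flow_in)

lemma flow_add:
  assumes "x \<in> K" "y \<in> K"
  shows "U s (x + y) = U s x + U s y"
proof (rule solution_unique[of "\<lambda>s. U s (x + y)" "\<lambda>s. U s x + U s y"])
  show "((\<lambda>s. U s x + U s y) has_vector_derivative Z (U s x + U s y)) (at s)" for s
    using assms by (auto simp: gen_add flow_in intro!: derivative_eq_intros flow_deriv)
qed (use assms in \<open>auto simp: flow_in flow_0 flow_deriv space_closed\<close>)

lemma flow_scale:
  assumes "x \<in> K"
  shows "U s (r *\<^sub>R x) = r *\<^sub>R U s x"
proof (rule solution_unique[of "\<lambda>s. U s (r *\<^sub>R x)" "\<lambda>s. r *\<^sub>R U s x"])
  show "((\<lambda>s. r *\<^sub>R U s x) has_vector_derivative Z (r *\<^sub>R U s x)) (at s)" for s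
    using assms bounded_linear.has_vector_derivative[OF bounded_linear_scaleR_right flow_deriv]
    by (simp add: gen_scale flow_in)
qed (use assms in \<open>auto simp: flow_in flow_0 flow_deriv space_closed\<close>)

lemma flow_diff: "x \<in> K \<Longrightarrow> y \<in> K \<Longrightarrow> U s (x - y) = U s x - U s y"
  using flow_add[of x "(-1) *\<^sub>R y"] flow_scale[of y s "-1"] space_closed(3)[of y "-1"] by simp

lemma flow_deriv_affine:
  assumes "x \<in> K"
  shows "((\<lambda>s. U (c * s + r) x) has_vector_derivative c *\<^sub>R Z (U (c * s + r) x)) (at s)"
proof -
  have "((\<lambda>s. c * s + r) has_vector_derivative c) (at s)"
    by (auto intro!: derivative_eq_intros)
  then show ?thesis
    using vector_diff_chain_at flow_deriv[OF assms] by (fastforce simp: o_def)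
qed

lemma flow_flow:
  assumes "x \<in> K"
  shows "U s (U r x) = U (s + r) x"
proof (rule solution_unique[of "\<lambda>s. U s (U r x)" "\<lambda>s. U (s + r) x"])
  show "((\<lambda>s. U (s + r) x) has_vector_derivative Z (U (s + r) x)) (at s)" for s
    using flow_deriv_affine[OF assms, of 1 r s] by simp
qed (use assms in \<open>auto simp: flow_in flow_0 flow_deriv\<close>)

text \<open>With \<open>c = 2\<close> a propagator at time \<open>2 * a\<close> becomes the flow of
  the doubled generator at time \<open>a\<close>, so all flows in the splitting estimate run for the
  same time.\<close>

lemma flow_scaled: "0 \<le> c \<Longrightarrow> bounded_flow K (\<lambda>x. c *\<^sub>R Z x) (\<lambda>s. U (c * s)) (c * M)"
proof
  fix x s assume "x \<in> K" "0 \<le> c"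
  show "((\<lambda>s. U (c * s) x) has_vector_derivative c *\<^sub>R Z (U (c * s) x)) (at s)"
    using flow_deriv_affine[OF \<open>x \<in> K\<close>, of c 0 s] by simp
  show "norm (c *\<^sub>R Z x) \<le> c * M * norm x"
    using gen_bound[OF \<open>x \<in> K\<close>] \<open>0 \<le> c\<close> by (simp add: mult_left_mono mult.assoc)
qed (auto simp: subspace gen_in gen_add gen_scale gen_skew flow_in flow_0 space_closed algebra_simps
      bound_nonneg)

lemma flow_reversed: "bounded_flow K (\<lambda>x. - Z x) (\<lambda>s. U (- s)) M"
proof
  fix x s assume "x \<in> K"
  show "((\<lambda>s. U (- s) x) has_vector_derivative - Z (U (- s) x)) (at s)"
    using flow_deriv_affine[OF \<open>x \<in> K\<close>, of "-1" 0 s] by simp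
qed (use bound_nonneg in \<open>auto simp: subspace gen_in gen_add gen_scale gen_skew flow_in flow_0 gen_bound
    subspace_neg[OF subspace]\<close>)

text \<open>The first of three remainders. The derivative of each later remainder is
  \<open>Z\<close> applied to the preceding one, so every further order costs one factor
  \<open>M\<close> and one use of the mean value inequality.\<close>

lemma flow_taylor_0:
  assumes "x \<in> K" "0 \<le> s"
  shows "norm (U s x - x) \<le> M * s * norm x"
proof -
  have "norm (U s x - x) \<le> (M * norm x) * s ^ Suc 0 / Suc 0"
  proof (rule norm_le_power_if_derivative_le_power)
    fix r :: real
    show "((\<lambda>s. U s x - x) has_vector_derivative Z (U r x)) (at r)"
      by (auto intro!: derivative_eq_intros flow_deriv assms)
    show "norm (Z (U r x)) \<le> M * norm x * r ^ 0"
      using gen_bound[of "U r x"] assms by (simp add: flow_in norm_flow)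
  qed (use assms flow_0 in auto)
  then show ?thesis by (simp add: mult_ac)
qed

lemma flow_taylor_1:
  assumes "x \<in> K" "0 \<le> s"
  shows "norm (U s x - x - s *\<^sub>R Z x) \<le> M\<^sup>2 * s\<^sup>2 / 2 * norm x"
proof -
  have "norm (U s x - x - s *\<^sub>R Z x) \<le> (M\<^sup>2 * norm x) * s ^ Suc 1 / Suc 1"
  proof (rule norm_le_power_if_derivative_le_power)
    fix r :: real assume "0 \<le> r"
    show "((\<lambda>s. U s x - x - s *\<^sub>R Z x) has_vector_derivative Z (U r x) - Z x) (at r)"
      by (auto intro!: derivative_eq_intros flow_deriv assms)
    have "norm (Z (U r x) - Z x) \<le> M * norm (U r x - x)"
      using gen_bound[of "U r x - x"] assms by (simp add: gen_diff flow_in space_closed)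
    also have "\<dots> \<le> M * (M * r * norm x)"
      using flow_taylor_0[OF assms(1) \<open>0 \<le> r\<close>] bound_nonneg by (rule mult_left_mono)
    finally show "norm (Z (U r x) - Z x) \<le> M\<^sup>2 * norm x * r ^ 1"
      by (simp add: power2_eq_square mult_ac)
  qed (use assms flow_0 in auto)
  then show ?thesis by (simp add: mult_ac power2_eq_square)
qed

lemma flow_taylor_2:
  assumes "x \<in> K" "0 \<le> s"
  shows "norm (U s x - x - s *\<^sub>R Z x - (s\<^sup>2 / 2) *\<^sub>R Z (Z x)) \<le> M ^ 3 * s ^ 3 / 6 * norm x"
proof -
  have "norm (U s x - x - s *\<^sub>R Z x - (s\<^sup>2 / 2) *\<^sub>R Z (Z x)) \<le> (M ^ 3 * norm x / 2) * s ^ Suc 2 / Suc 2"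
  proof (rule norm_le_power_if_derivative_le_power)
    fix r :: real assume "0 \<le> r"
    show "((\<lambda>s. U s x - x - s *\<^sub>R Z x - (s\<^sup>2 / 2) *\<^sub>R Z (Z x)) has_vector_derivative
        Z (U r x) - Z x - r *\<^sub>R Z (Z x)) (at r)"
      by (auto intro!: derivative_eq_intros flow_deriv assms)
    have "norm (Z (U r x) - Z x - r *\<^sub>R Z (Z x)) \<le> M * norm (U r x - x - r *\<^sub>R Z x)"
      using gen_bound[of "U r x - x - r *\<^sub>R Z x"] assms
      by (simp add: gen_diff flow_in space_closed gen_in gen_scale)
    also have "\<dots> \<le> M * (M\<^sup>2 * r\<^sup>2 / 2 * norm x)"
      using flow_taylor_1[OF assms(1) \<open>0 \<le> r\<close>] bound_nonneg by (rule mult_left_mono)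
    finally show "norm (Z (U r x) - Z x - r *\<^sub>R Z (Z x)) \<le> M ^ 3 * norm x / 2 * r ^ 2"
      by (simp add: power2_eq_square power3_eq_cube mult_ac)
  qed (use assms flow_0 in auto)
  then show ?thesis by (simp add: mult_ac power3_eq_cube power2_eq_square)
qed

text \<open>Differentiability in time needs increments of both signs; a negative time is a positive
  time of the reversed flow.\<close>

lemma flow_taylor_1_two_sided:
  assumes "x \<in> K"
  shows "norm (U s x - x - s *\<^sub>R Z x) \<le> M\<^sup>2 * s\<^sup>2 / 2 * norm x"
proof (cases "0 \<le> s")
  case False
  then show ?thesis
    using bounded_flow.flow_taylor_1[OF flow_reversed assms, of "- s"] by simp
qed (rule flow_taylor_1[OF assms])

end

section \<open>Local error of the symmetric splitting\<close>

text \<open>Both sides have the same terms up to second order. A term that already has order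
  \<open>j\<close> is expanded by the next factor only up to order \<open>2 - j\<close>, so every
  remainder is of third order exactly and the bound holds for all \<open>s \<ge> 0\<close> without a
  smallness condition.\<close>

lemma strang_splitting_bound:
  assumes "bounded_flow K P U m" "bounded_flow K Q W m" "bounded_flow K R X m"
    and R: "\<And>x. x \<in> K \<Longrightarrow> R x = 2 *\<^sub>R P x + Q x"
    and x: "x \<in> K" and s: "0 \<le> s"
  shows "norm (U s (W s (U s x)) - X s x) \<le> 5 * (m * s) ^ 3 * norm x"
proof -
  interpret U: bounded_flow K P U m by fact
  interpret W: bounded_flow K Q W m by fact
  interpret X: bounded_flow K R X m by fact
  note in_K = x U.gen_in W.gen_in U.flow_in W.flow_in U.space_closed
  define k where "k = m * s"
  have m: "0 \<le> m" and k: "0 \<le> k" using U.bound_nonneg s by (auto simp: k_def)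
  note norms = U.norm_flow W.norm_flow
  \<comment> \<open>The digit in these names is the degree of the Taylor polynomial that is
    subtracted.\<close>
  define rU2 where "rU2 = (\<lambda>y. U s y - y - s *\<^sub>R P y - (s\<^sup>2 / 2) *\<^sub>R P (P y))"
  define rU1 where "rU1 = (\<lambda>y. U s y - y - s *\<^sub>R P y)"
  define rU0 where "rU0 = (\<lambda>y. U s y - y)"
  define rW2 where "rW2 = (\<lambda>y. W s y - y - s *\<^sub>R Q y - (s\<^sup>2 / 2) *\<^sub>R Q (Q y))"
  define rW1 where "rW1 = (\<lambda>y. W s y - y - s *\<^sub>R Q y)"
  define rW0 where "rW0 = (\<lambda>y. W s y - y)"
  define rX2 where "rX2 = (\<lambda>y. X s y - y - s *\<^sub>R R y - (s\<^sup>2 / 2) *\<^sub>R R (R y))"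
  define c where "c = norm x"
  have c: "0 \<le> c" by (simp add: c_def)
  \<comment> \<open>The parts of first and second order in \<open>s\<close> of the product of the
    two inner factors applied to \<open>x\<close>.\<close>
  define y1 where "y1 = s *\<^sub>R P x + s *\<^sub>R Q x"
  define y2 where "y2 = (s\<^sup>2 / 2) *\<^sub>R (Q (Q x) + 2 *\<^sub>R Q (P x) + P (P x))"
  have rU_in: "rU2 y \<in> K" "rU1 y \<in> K" "rU0 y \<in> K" if "y \<in> K" for y
    using that by (auto simp: rU2_def rU1_def rU0_def intro!: in_K)
  have rW_in: "rW2 y \<in> K" "rW1 y \<in> K" "rW0 y \<in> K" if "y \<in> K" for y
    using that by (auto simp: rW2_def rW1_def rW0_def intro!: in_K)
  have y_in: "y1 \<in> K" "y2 \<in> K"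
    by (auto simp: y1_def y2_def intro!: in_K)
  \<comment> \<open>The remainders left by the two inner factors. Each has order three: the powers
    of \<open>s\<close> in front make up for the lower degree of the Taylor polynomial.\<close>
  define e where "e = W s (rU2 x) + rW2 x + s *\<^sub>R rW1 (P x) + (s\<^sup>2 / 2) *\<^sub>R rW0 (P (P x))"
  have e_in: "e \<in> K"
    by (auto simp: e_def intro!: in_K rU_in rW_in)
  have WU: "W s (U s x) = x + y1 + y2 + e"
  proof -
    have "U s x = rU2 x + x + s *\<^sub>R P x + (s\<^sup>2 / 2) *\<^sub>R P (P x)"
      by (simp add: rU2_def)
    then have "W s (U s x) = W s (rU2 x) + W s x + s *\<^sub>R W s (P x) + (s\<^sup>2 / 2) *\<^sub>R W s (P (P x))"
      using rU_in[of x] by (simp add: in_K W.flow_add W.flow_scale)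
    also have "W s x = rW2 x + x + s *\<^sub>R Q x + (s\<^sup>2 / 2) *\<^sub>R Q (Q x)"
      by (simp add: rW2_def)
    also have "W s (P x) = rW1 (P x) + P x + s *\<^sub>R Q (P x)"
      by (simp add: rW1_def)
    also have "W s (P (P x)) = rW0 (P (P x)) + P (P x)"
      by (simp add: rW0_def)
    finally show ?thesis
      by (simp add: e_def y1_def y2_def algebra_simps power2_eq_square)
  qed
  have expand: "U s (W s (U s x)) = U s x + U s y1 + U s y2 + U s e"
    unfolding WU using y_in e_in by (simp add: in_K U.flow_add)
  have expansions: "U s x = rU2 x + x + s *\<^sub>R P x + (s\<^sup>2 / 2) *\<^sub>R P (P x)"
      "U s y1 = rU1 y1 + y1 + s *\<^sub>R P y1" "U s y2 = rU0 y2 + y2"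
    by (simp_all add: rU2_def rU1_def rU0_def)
  have Py1: "P y1 = s *\<^sub>R P (P x) + s *\<^sub>R P (Q x)"
    unfolding y1_def by (simp add: in_K U.gen_add U.gen_scale)
  have UWU: "U s (W s (U s x)) = rU2 x + x + s *\<^sub>R P x + (s\<^sup>2 / 2) *\<^sub>R P (P x)
      + (rU1 y1 + y1 + s *\<^sub>R (s *\<^sub>R P (P x) + s *\<^sub>R P (Q x))) + (rU0 y2 + y2) + U s e"
    unfolding expand unfolding expansions Py1 ..
  have RR: "R (R x) = 4 *\<^sub>R P (P x) + 2 *\<^sub>R P (Q x) + 2 *\<^sub>R Q (P x) + Q (Q x)"
    by (simp add: in_K R U.gen_add W.gen_add U.gen_scale W.gen_scale scaleR_add_right)
  have Xx: "X s x = rX2 x + x + s *\<^sub>R (2 *\<^sub>R P x + Q x)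
      + (s\<^sup>2 / 2) *\<^sub>R (4 *\<^sub>R P (P x) + 2 *\<^sub>R P (Q x) + 2 *\<^sub>R Q (P x) + Q (Q x))"
    unfolding RR[symmetric] R[OF x, symmetric] by (simp add: rX2_def)
  \<comment> \<open>The second order terms cancel: with \<open>P P\<close> standing for
    \<open>P (P x)\<close> and so on, both sides contain \<open>s\<close> squared times
    \<open>2 P P + P Q + Q P + Q Q / 2\<close>.\<close>
  have diff: "U s (W s (U s x)) - X s x = rU2 x + rU1 y1 + rU0 y2 + U s e - rX2 x"
    unfolding UWU Xx y1_def y2_def
    by (simp add: algebra_simps power2_eq_square flip: scaleR_add_left)
  have nP: "norm (s *\<^sub>R P y) \<le> k * norm y" if "y \<in> K" for y
    using mult_left_mono[OF U.gen_bound[OF that] s] s by (simp add: k_def mult_ac)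
  have nQ: "norm (s *\<^sub>R Q y) \<le> k * norm y" if "y \<in> K" for y
    using mult_left_mono[OF W.gen_bound[OF that] s] s by (simp add: k_def mult_ac)
  have b1: "norm (rU2 x) \<le> k ^ 3 / 6 * c" "norm (rW2 x) \<le> k ^ 3 / 6 * c" "norm (rX2 x) \<le> k ^ 3 / 6 * c"
    using U.flow_taylor_2[OF x s] W.flow_taylor_2[OF x s] X.flow_taylor_2[OF x s]
    by (simp_all add: rU2_def rW2_def rX2_def k_def c_def power_mult_distrib)
  have b2: "norm (rU1 y) \<le> k\<^sup>2 / 2 * norm y" "norm (rW1 y) \<le> k\<^sup>2 / 2 * norm y" if "y \<in> K" for y
    using U.flow_taylor_1[OF that s] W.flow_taylor_1[OF that s]
    by (simp_all add: rU1_def rW1_def k_def power_mult_distrib)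
  have b3: "norm (rU0 y) \<le> k * norm y" "norm (rW0 y) \<le> k * norm y" if "y \<in> K" for y
    using U.flow_taylor_0[OF that s] W.flow_taylor_0[OF that s]
    by (simp_all add: rU0_def rW0_def k_def)
  have two: "norm ((s\<^sup>2) *\<^sub>R A (B x)) \<le> k\<^sup>2 * c"
    if "\<And>y. y \<in> K \<Longrightarrow> norm (s *\<^sub>R A y) \<le> k * norm y" "\<And>y. y \<in> K \<Longrightarrow> norm (s *\<^sub>R B y) \<le> k * norm y"
      "B x \<in> K" for A B
  proof -
    have "norm ((s\<^sup>2) *\<^sub>R A (B x)) = s * norm (s *\<^sub>R A (B x))"
      using s by (simp add: power2_eq_square)
    also have "\<dots> \<le> s * (k * norm (B x))"
      using that s by (intro mult_left_mono) auto
    also have "\<dots> = k * norm (s *\<^sub>R B x)" using s by simp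
    also have "\<dots> \<le> k * (k * norm x)"
      using that x k by (intro mult_left_mono) auto
    finally show ?thesis by (simp add: power2_eq_square c_def)
  qed
  have PP: "norm (s\<^sup>2 *\<^sub>R P (P x)) \<le> k\<^sup>2 * c" and QP: "norm (s\<^sup>2 *\<^sub>R Q (P x)) \<le> k\<^sup>2 * c"
    and QQ: "norm (s\<^sup>2 *\<^sub>R Q (Q x)) \<le> k\<^sup>2 * c"
    using two[of P P] two[of Q P] two[of Q Q] nP nQ by (auto intro: in_K)
  have n1: "norm y1 \<le> 2 * k * c"
    unfolding y1_def using nP[OF x] nQ[OF x]
    by (intro order_trans[OF norm_triangle_ineq]) (simp add: c_def)
  have n2: "norm y2 \<le> 2 * k\<^sup>2 * c"
  proof -
    have "y2 = (1 / 2) *\<^sub>R (s\<^sup>2 *\<^sub>R Q (Q x)) + s\<^sup>2 *\<^sub>R Q (P x) + (1 / 2) *\<^sub>R (s\<^sup>2 *\<^sub>R P (P x))"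
      by (simp add: y2_def algebra_simps)
    also have "norm \<dots> \<le> norm ((1 / 2) *\<^sub>R (s\<^sup>2 *\<^sub>R Q (Q x))) + norm (s\<^sup>2 *\<^sub>R Q (P x))
        + norm ((1 / 2) *\<^sub>R (s\<^sup>2 *\<^sub>R P (P x)))"
      by (rule order_trans[OF norm_triangle_ineq add_right_mono[OF norm_triangle_ineq]])
    also have "\<dots> = norm (s\<^sup>2 *\<^sub>R Q (Q x)) / 2 + norm (s\<^sup>2 *\<^sub>R Q (P x)) + norm (s\<^sup>2 *\<^sub>R P (P x)) / 2"
      by simp
    finally show ?thesis using PP QP QQ by linarith
  qed
  have n3: "norm (rU1 y1) \<le> k ^ 3 * c"
  proof -
    have "norm (rU1 y1) \<le> k\<^sup>2 / 2 * norm y1" by (rule b2[OF y_in(1)])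
    also have "\<dots> \<le> k\<^sup>2 / 2 * (2 * k * c)" by (intro mult_left_mono n1) simp
    finally show ?thesis by (simp add: power2_eq_square power3_eq_cube mult_ac)
  qed
  have n4: "norm (rU0 y2) \<le> 2 * k ^ 3 * c"
  proof -
    have "norm (rU0 y2) \<le> k * norm y2" by (rule b3[OF y_in(2)])
    also have "\<dots> \<le> k * (2 * k\<^sup>2 * c)" by (intro mult_left_mono n2 k)
    finally show ?thesis by (simp add: power2_eq_square power3_eq_cube mult_ac)
  qed
  have n5: "norm (s *\<^sub>R rW1 (P x)) \<le> k ^ 3 / 2 * c"
  proof -
    have "norm (s *\<^sub>R rW1 (P x)) = s * norm (rW1 (P x))" using s by simp
    also have "\<dots> \<le> s * (k\<^sup>2 / 2 * norm (P x))"
      by (intro mult_left_mono b2 s in_K)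
    also have "\<dots> = k\<^sup>2 / 2 * norm (s *\<^sub>R P x)" using s by simp
    also have "\<dots> \<le> k\<^sup>2 / 2 * (k * c)"
      unfolding c_def by (intro mult_left_mono nP x) simp
    finally show ?thesis by (simp add: power2_eq_square power3_eq_cube mult_ac)
  qed
  have n6: "norm ((s\<^sup>2 / 2) *\<^sub>R rW0 (P (P x))) \<le> k ^ 3 / 2 * c"
  proof -
    have "norm ((s\<^sup>2 / 2) *\<^sub>R rW0 (P (P x))) = s\<^sup>2 / 2 * norm (rW0 (P (P x)))" by simp
    also have "\<dots> \<le> s\<^sup>2 / 2 * (k * norm (P (P x)))"
      by (intro mult_left_mono b3 in_K) simp
    also have "\<dots> = k / 2 * norm (s\<^sup>2 *\<^sub>R P (P x))" by simp
    also have "\<dots> \<le> k / 2 * (k\<^sup>2 * c)"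
      by (intro mult_left_mono PP) (use k in simp)
    finally show ?thesis by (simp add: power2_eq_square power3_eq_cube mult_ac)
  qed
  have "norm e \<le> norm (W s (rU2 x)) + norm (rW2 x) + norm (s *\<^sub>R rW1 (P x)) + norm ((s\<^sup>2 / 2) *\<^sub>R rW0 (P (P x)))"
    unfolding e_def by (meson norm_triangle_ineq norm_triangle_mono add_right_mono order_trans order_refl)
  also have "\<dots> \<le> (4 / 3) * k ^ 3 * c"
    using b1 n5 n6 rU_in[OF x] by (simp add: norms)
  finally have ne: "norm (U s e) \<le> (4 / 3) * k ^ 3 * c"
    using e_in by (simp add: norms)
  have "norm (U s (W s (U s x)) - X s x)
      \<le> norm (rU2 x) + norm (rU1 y1) + norm (rU0 y2) + norm (U s e) + norm (rX2 x)"
    unfolding diff by (meson norm_triangle_ineq norm_triangle_ineq4 norm_triangle_mono add_right_mono order_trans order_refl)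
  \<comment> \<open>The five contributions are 1/6, 1, 2, 4/3 and 1/6. Their sum 14/3 is rounded up
    to 5.\<close>
  also have "\<dots> \<le> 5 * (k ^ 3 * c)"
    using b1 n3 n4 ne mult_nonneg_nonneg[OF zero_le_power[OF k, of 3] c] by simp
  finally show ?thesis
    by (simp add: k_def c_def)
qed

section \<open>Exponential series in finite dimension\<close>

text \<open>The exponential of \<open>s T\<close> applied to \<open>x\<close>, written with iterates
  because \<open>T\<close> is a bare function and not an element of a normed algebra. The parameter
  \<open>s\<close> is real; the factor \<open>- \<i>\<close> is absorbed into
  \<open>T\<close>.\<close>

definition exp_series :: "('v::euclidean_space \<Rightarrow> 'v) \<Rightarrow> real \<Rightarrow> 'v \<Rightarrow> 'v" where
  "exp_series T s x = (\<Sum>k. (s ^ k / fact k) *\<^sub>R (T ^^ k) x)"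

lemma exp_series_0: "exp_series T 0 x = x"
proof -
  have "(\<Sum>k. (0 ^ k / fact k) *\<^sub>R (T ^^ k) x) = (\<Sum>k\<in>{0}. (0 ^ k / fact k) *\<^sub>R (T ^^ k) x)"
    by (rule suminf_finite) auto
  then show ?thesis by (simp add: exp_series_def)
qed

lemma norm_funpow_le:
  fixes T :: "'v::real_normed_vector \<Rightarrow> 'v"
  assumes "\<And>x. norm (T x) \<le> M * norm x" "0 \<le> M"
  shows "norm ((T ^^ k) x) \<le> M ^ k * norm x"
proof (induction k)
  case (Suc k)
  have "norm ((T ^^ Suc k) x) \<le> M * norm ((T ^^ k) x)" using assms(1) by simp
  also have "\<dots> \<le> M * (M ^ k * norm x)" by (intro mult_left_mono Suc assms(2))
  finally show ?case by (simp add: mult.assoc)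
qed simp

context
  fixes T :: "'v::euclidean_space \<Rightarrow> 'v" and M :: real
  assumes bound: "\<And>x. norm (T x) \<le> M * norm x" and nonneg: "0 \<le> M"
begin

lemma summable_exp_series: "summable (\<lambda>k. (s ^ k / fact k) *\<^sub>R (T ^^ k) x)"
proof (rule summable_comparison_test')
  show "summable (\<lambda>k. inverse (fact k) * (M * \<bar>s\<bar>) ^ k * norm x)"
    by (intro summable_mult2 summable_exp)
  fix k
  have "norm ((s ^ k / fact k) *\<^sub>R (T ^^ k) x) = \<bar>s\<bar> ^ k / fact k * norm ((T ^^ k) x)"
    by (simp add: power_abs)
  also have "\<dots> \<le> \<bar>s\<bar> ^ k / fact k * (M ^ k * norm x)"
    by (intro mult_left_mono norm_funpow_le bound nonneg) simp
  finally show "norm ((s ^ k / fact k) *\<^sub>R (T ^^ k) x) \<le> inverse (fact k) * (M * \<bar>s\<bar>) ^ k * norm x"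
    by (simp add: power_mult_distrib field_simps)
qed

lemma exp_series_apply:
  assumes "linear T"
  shows "T (exp_series T s x) = exp_series T s (T x)"
proof -
  have bl: "bounded_linear T" using assms by (rule linear_conv_bounded_linear[THEN iffD1])
  have "T (exp_series T s x) = (\<Sum>k. T ((s ^ k / fact k) *\<^sub>R (T ^^ k) x))"
    unfolding exp_series_def
    by (rule bounded_linear.suminf[OF bl summable_exp_series])
  also have "\<dots> = exp_series T s (T x)"
    unfolding exp_series_def
    by (rule suminf_cong) (simp add: linear_cmul[OF assms] funpow_swap1)
  finally show ?thesis .
qed

text \<open>Every coordinate is a scalar power series in \<open>s\<close> that converges everywhere.
  Differentiating it termwise shifts the coefficients, and since the factor \<open>k + 1\<close>
  cancels in the factorial, the shift amounts to replacing \<open>x\<close> by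
  \<open>T x\<close>.\<close>

lemma exp_series_deriv:
  assumes "linear T"
  shows "((\<lambda>s. exp_series T s x) has_vector_derivative T (exp_series T s x)) (at s)"
proof -
  have comp: "exp_series T r y \<bullet> b = (\<Sum>k. ((T ^^ k) y \<bullet> b) / fact k * r ^ k)" for r y b
    unfolding exp_series_def
    by (subst bounded_linear.suminf[OF bounded_linear_inner_left summable_exp_series])
      (simp add: mult.commute)
  have "((\<lambda>r. exp_series T r x \<bullet> b) has_real_derivative exp_series T s (T x) \<bullet> b) (at s)" for b
  proof -
    let ?c = "\<lambda>k. ((T ^^ k) x \<bullet> b) / fact k"
    have "summable (\<lambda>k. ?c k * r ^ k)" for r
      using bounded_linear.summable[OF bounded_linear_inner_left summable_exp_series[of r x], of b]
      by (simp add: mult.commute)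
    then have "((\<lambda>r. \<Sum>k. ?c k * r ^ k) has_real_derivative (\<Sum>k. diffs ?c k * s ^ k)) (at s)"
      by (rule termdiffs_strong_converges_everywhere)
    moreover have "diffs ?c k = ((T ^^ k) (T x) \<bullet> b) / fact k" for k
      by (simp add: diffs_def funpow_swap1 fact_Suc del: of_nat_Suc)
    ultimately show ?thesis by (simp add: comp)
  qed
  then have "((\<lambda>s. exp_series T s x) has_vector_derivative exp_series T s (T x)) (at s)"
    unfolding has_vector_derivative_def
    by (subst has_derivative_componentwise_within)
      (auto simp: has_real_derivative_iff_has_vector_derivative has_vector_derivative_def)
  then show ?thesis by (simp add: exp_series_apply[OF assms])
qed

lemma bounded_flow_exp_series:
  assumes "linear T" "\<And>x. T x \<bullet> x = 0"
  shows "bounded_flow UNIV T (exp_series T) M"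
  by unfold_locales
    (use assms bound nonneg in \<open>auto simp: exp_series_0 linear_add linear_cmul exp_series_deriv\<close>)

end

section \<open>An inequality of Plancherel type\<close>

lemma integral_lborel_prod:
  fixes f :: "'a::euclidean_space \<Rightarrow> real \<Rightarrow> 'b::{real_normed_field,banach,second_countable_topology}"
  assumes f: "\<And>b. b \<in> Basis \<Longrightarrow> integrable lborel (f b)"
  shows "(\<integral>x. (\<Prod>b\<in>Basis. f b (x \<bullet> b)) \<partial>lborel) = (\<Prod>b\<in>Basis. integral\<^sup>L lborel (f b))"
    and "integrable lborel (\<lambda>x. \<Prod>b\<in>Basis. f b (x \<bullet> b))"
proof -
  interpret product_sigma_finite "\<lambda>_::'a. lborel :: real measure" ..
  have [measurable]: "f b \<in> borel_measurable borel" if "b \<in> Basis" for b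
    using borel_measurable_integrable[OF f[OF that]] by simp
  have coord: "(\<Prod>b\<in>Basis. f b ((\<Sum>i\<in>Basis. x i *\<^sub>R i) \<bullet> b)) = (\<Prod>b\<in>Basis. f b (x b))" for x
    by (intro prod.cong) simp_all
  show "(\<integral>x. (\<Prod>b\<in>Basis. f b (x \<bullet> b)) \<partial>lborel) = (\<Prod>b\<in>Basis. integral\<^sup>L lborel (f b))"
    by (subst lborel_eq, subst integral_distr)
      (simp_all add: coord product_integral_prod f)
  show "integrable lborel (\<lambda>x. \<Prod>b\<in>Basis. f b (x \<bullet> b))"
    by (subst lborel_eq, subst integrable_distr_eq)
      (simp_all add: coord product_integrable_prod f)
qed

text \<open>A convergence factor: it makes the squared Fourier integral integrable before the
  transform is known to be square-integrable, and it increases to 1 as \<open>\<epsilon>\<close>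
  decreases to 0. The product form lets its transform be computed coordinate by coordinate.\<close>

definition gauss :: "real \<Rightarrow> 'a::euclidean_space \<Rightarrow> real" where
  "gauss \<epsilon> x = (\<Prod>b\<in>Basis. exp (- (\<epsilon> * (x \<bullet> b))\<^sup>2 / 2))"

text \<open>The Fourier transform of \<^term>\<open>gauss \<epsilon>\<close>, an approximate identity as \<open>\<epsilon> \<rightarrow> 0\<close>.\<close>

definition gauss_hat :: "real \<Rightarrow> 'a::euclidean_space \<Rightarrow> real" where
  "gauss_hat \<epsilon> k = (\<Prod>b\<in>Basis. 2 * pi * normal_density 0 \<epsilon> (k \<bullet> b))"

lemma gauss_measurable [measurable]: "gauss \<epsilon> \<in> borel_measurable borel"
  unfolding gauss_def by measurable

lemma gauss_hat_measurable [measurable]: "gauss_hat \<epsilon> \<in> borel_measurable borel"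
  unfolding gauss_hat_def by measurable

lemma gauss_nonneg: "0 \<le> gauss \<epsilon> x"
  by (simp add: gauss_def prod_nonneg)

lemma gauss_hat_nonneg: "0 \<le> gauss_hat \<epsilon> x"
  by (simp add: gauss_hat_def prod_nonneg)

lemma gauss_eq_normal_density:
  assumes "0 < \<epsilon>"
  shows "exp (- (\<epsilon> * x)\<^sup>2 / 2) = sqrt (2 * pi) / \<epsilon> * normal_density 0 (1 / \<epsilon>) x"
  using assms by (simp add: normal_density_def real_sqrt_divide power_divide power_mult_distrib field_simps)

lemma integrable_gauss:
  assumes "0 < \<epsilon>"
  shows "integrable lborel (gauss \<epsilon>)"
  unfolding gauss_def gauss_eq_normal_density[OF assms]
  by (rule integral_lborel_prod(2)) (use assms in simp)

lemma
  assumes "0 < \<epsilon>"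
  shows integrable_gauss_hat: "integrable lborel (gauss_hat \<epsilon> :: 'a::euclidean_space \<Rightarrow> real)"
    and integral_gauss_hat: "integral\<^sup>L lborel (gauss_hat \<epsilon> :: 'a \<Rightarrow> real) = (2 * pi) ^ DIM('a)"
  using integral_lborel_prod[of "\<lambda>b::'a. \<lambda>x. 2 * pi * normal_density 0 \<epsilon> x"] assms
  unfolding gauss_hat_def by simp_all

text \<open>The substitution of \<open>x / \<epsilon>\<close> for \<open>x\<close> turns the
  integral into a multiple of the characteristic function of the standard normal distribution at
  \<open>k / \<epsilon>\<close>.\<close>

lemma
  assumes "0 < \<epsilon>"
  shows fourier_gauss_real:
      "(\<integral>x. exp (\<i> * of_real (k * x)) * of_real (exp (- (\<epsilon> * x)\<^sup>2 / 2)) \<partial>lborel)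
        = complex_of_real (2 * pi * normal_density 0 \<epsilon> k)"
    and integrable_fourier_gauss_real:
      "integrable lborel (\<lambda>x. exp (\<i> * of_real (k * x)) * complex_of_real (exp (- (\<epsilon> * x)\<^sup>2 / 2)))"
proof -
  have "integrable lborel (\<lambda>x. complex_of_real (exp (- (\<epsilon> * x)\<^sup>2 / 2)))"
    unfolding gauss_eq_normal_density[OF assms] using assms by simp
  then show "integrable lborel (\<lambda>x. exp (\<i> * of_real (k * x)) * complex_of_real (exp (- (\<epsilon> * x)\<^sup>2 / 2)))"
    by (rule Bochner_Integration.integrable_bound) (auto simp: norm_mult)
  have "(\<integral>x. exp (\<i> * of_real (k * x)) * of_real (exp (- (\<epsilon> * x)\<^sup>2 / 2)) \<partial>lborel)
      = (1 / \<epsilon>) *\<^sub>R (\<integral>x. exp (\<i> * of_real (k / \<epsilon> * x)) * complex_of_real (exp (- x\<^sup>2 / 2)) \<partial>lborel)"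
    using assms by (subst lborel_integral_real_affine[of "1 / \<epsilon>" _ 0]) simp_all
  also have "(\<integral>x. exp (\<i> * of_real (k / \<epsilon> * x)) * complex_of_real (exp (- x\<^sup>2 / 2)) \<partial>lborel)
      = (\<integral>x. sqrt (2 * pi) *\<^sub>R (std_normal_density x *\<^sub>R exp (\<i> * of_real (k / \<epsilon> * x))) \<partial>lborel)"
    by (intro Bochner_Integration.integral_cong) (simp_all add: std_normal_density_def scaleR_conv_of_real)
  also have "\<dots> = sqrt (2 * pi) *\<^sub>R (\<integral>x. std_normal_density x *\<^sub>R exp (\<i> * of_real (k / \<epsilon> * x)) \<partial>lborel)"
    by (rule integral_scaleR_right)
  also have "\<dots> = sqrt (2 * pi) *\<^sub>R char std_normal_distribution (k / \<epsilon>)"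
    unfolding char_def by (subst integral_density) simp_all
  also have "(1 / \<epsilon>) *\<^sub>R (sqrt (2 * pi) *\<^sub>R char std_normal_distribution (k / \<epsilon>))
      = complex_of_real (sqrt (2 * pi) / \<epsilon> * exp (- (k / \<epsilon>)\<^sup>2 / 2))"
    unfolding char_std_normal_distribution by (simp add: scaleR_conv_of_real)
  also have "sqrt (2 * pi) / \<epsilon> * exp (- (k / \<epsilon>)\<^sup>2 / 2) = 2 * pi * normal_density 0 \<epsilon> k"
  proof -
    have "2 * pi = sqrt (2 * pi) * sqrt (2 * pi)" by simp
    then show ?thesis
      using assms unfolding normal_density_def
      by (simp add: real_sqrt_mult power_divide del: real_sqrt_mult_self)
  qed
  finally show "(\<integral>x. exp (\<i> * of_real (k * x)) * of_real (exp (- (\<epsilon> * x)\<^sup>2 / 2)) \<partial>lborel)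
        = complex_of_real (2 * pi * normal_density 0 \<epsilon> k)" .
qed

lemma
  fixes k :: "'a::euclidean_space"
  assumes "0 < \<epsilon>"
  shows fourier_gauss: "(\<integral>x. of_real (gauss \<epsilon> x) * exp (\<i> * of_real (k \<bullet> x)) \<partial>lborel)
      = complex_of_real (gauss_hat \<epsilon> k)"
    and integrable_fourier_gauss:
      "integrable lborel (\<lambda>x. of_real (gauss \<epsilon> x) * exp (\<i> * of_real (k \<bullet> x)))"
proof -
  have eq: "of_real (gauss \<epsilon> x) * exp (\<i> * of_real (k \<bullet> x)) = (\<Prod>b\<in>Basis.
      exp (\<i> * of_real ((k \<bullet> b) * (x \<bullet> b))) * complex_of_real (exp (- (\<epsilon> * (x \<bullet> b))\<^sup>2 / 2)))" for x
    by (subst (1) euclidean_inner)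
      (simp add: gauss_def prod.distrib exp_sum sum_distrib_left mult.commute)
  show "(\<integral>x. of_real (gauss \<epsilon> x) * exp (\<i> * of_real (k \<bullet> x)) \<partial>lborel)
      = complex_of_real (gauss_hat \<epsilon> k)"
    unfolding eq gauss_hat_def of_real_prod fourier_gauss_real[OF assms, symmetric]
    by (rule integral_lborel_prod(1)) (rule integrable_fourier_gauss_real[OF assms])
  show "integrable lborel (\<lambda>x. of_real (gauss \<epsilon> x) * exp (\<i> * of_real (k \<bullet> x)))"
    unfolding eq by (rule integral_lborel_prod(2)) (rule integrable_fourier_gauss_real[OF assms])
qed

lemma vec_scale_conv_scaleR:
  "c *s v = Re c *\<^sub>R v + Im c *\<^sub>R (\<i> *s v)" for v :: "complex ^ 'c"
  by (simp add: vec_eq_iff complex_eq_iff)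

lemma vec_scale_of_real: "of_real r *s v = r *\<^sub>R v" for v :: "complex ^ 'c"
  by (simp add: vec_eq_iff complex_eq_iff)

lemma vec_scale_of_real_mult: "(of_real r * c) *s v = r *\<^sub>R (c *s v)" for v :: "complex ^ 'c"
  by (simp add: vec_eq_iff complex_eq_iff algebra_simps)

lemma measurable_vec_scale [measurable]:
  fixes g :: "'x \<Rightarrow> complex ^ 'c"
  assumes [measurable]: "f \<in> borel_measurable M" "g \<in> borel_measurable M"
  shows "(\<lambda>x. f x *s g x) \<in> borel_measurable M"
proof -
  have "(\<lambda>x. \<i> *s g x) \<in> borel_measurable M"
    by (rule borel_measurable_continuous_on[OF linear_continuous_on[OF bounded_linear_vec_complex_scale]])
      measurable
  then show ?thesis
    by (subst vec_scale_conv_scaleR) measurable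
qed

lemma norm_vec_scale: "norm (c *s v) = norm c * norm v" for v :: "complex ^ 'c"
  by (simp add: norm_vec_def norm_mult L2_set_right_distrib)

lemma bounded_linear_vec_scale_left: "bounded_linear (\<lambda>c. c *s v)" for v :: "complex ^ 'c"
  by (rule linear_conv_bounded_linear[THEN iffD1], rule linearI)
    (auto simp: vec_eq_iff algebra_simps)

lemma inner_vec_scale: "(c *s u) \<bullet> v = u \<bullet> (cnj c *s v)" for u v :: "complex ^ 'c"
  by (simp add: inner_vec_def inner_complex_def algebra_simps)

lemma lborel_integral_translate:
  fixes f :: "'a::euclidean_space \<Rightarrow> 'b::{banach,second_countable_topology}"
  assumes "integrable lborel f"
  shows "integrable lborel (\<lambda>x. f (x - h))" "(\<integral>x. f (x - h) \<partial>lborel) = integral\<^sup>L lborel f"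
proof -
  have [measurable]: "f \<in> borel_measurable borel"
    using borel_measurable_integrable[OF assms] by simp
  have "integrable (distr lborel borel ((+) (- h))) f"
    using assms by (simp add: lborel_distr_plus)
  then show "integrable lborel (\<lambda>x. f (x - h))"
    by (subst (asm) integrable_distr_eq) auto
  have "integral\<^sup>L (distr lborel borel ((+) (- h))) f = (\<integral>x. f (x - h) \<partial>lborel)"
    by (subst integral_distr) auto
  then show "(\<integral>x. f (x - h) \<partial>lborel) = integral\<^sup>L lborel f"
    by (simp add: lborel_distr_plus)
qed

lemma integrable_lborel_mult_pair:
  fixes f :: "'a::euclidean_space \<Rightarrow> real" and g :: "'b::euclidean_space \<Rightarrow> real"
  assumes "integrable lborel f" "integrable lborel g"
  shows "integrable (lborel \<Otimes>\<^sub>M lborel) (\<lambda>z. f (fst z) * g (snd z))"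
proof (rule lborel_pair.Fubini_integrable)
  show "integrable lborel (\<lambda>x. \<integral>y. norm (f (fst (x, y)) * g (snd (x, y))) \<partial>lborel)"
    using assms by (simp add: abs_mult)
qed (use assms in \<open>auto dest!: borel_measurable_integrable\<close>)

lemma integral_lborel_inner_pair:
  fixes f :: "'a::euclidean_space \<Rightarrow> 'v::euclidean_space" and g :: "'b::euclidean_space \<Rightarrow> 'v"
  assumes f: "integrable lborel f" and g: "integrable lborel g"
  shows "(\<integral>z. f (fst z) \<bullet> g (snd z) \<partial>(lborel \<Otimes>\<^sub>M lborel)) = integral\<^sup>L lborel f \<bullet> integral\<^sup>L lborel g"
proof -
  have [measurable]: "f \<in> borel_measurable borel" "g \<in> borel_measurable borel"
    using f g by (auto dest: borel_measurable_integrable)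
  have *: "integrable (lborel \<Otimes>\<^sub>M lborel) (\<lambda>z. f (fst z) \<bullet> g (snd z))"
    by (rule Bochner_Integration.integrable_bound[OF
          integrable_lborel_mult_pair[OF integrable_norm[OF f] integrable_norm[OF g]]])
      (auto simp: Cauchy_Schwarz_ineq2)
  show "(\<integral>z. f (fst z) \<bullet> g (snd z) \<partial>(lborel \<Otimes>\<^sub>M lborel)) = integral\<^sup>L lborel f \<bullet> integral\<^sup>L lborel g"
    using f g by (subst lborel_pair.integral_fst'[OF *, symmetric]) simp
qed

lemma
  fixes K f :: "'a::euclidean_space \<Rightarrow> real"
  assumes K: "integrable lborel K" "\<And>x. 0 \<le> K x" and f: "integrable lborel f" "\<And>x. 0 \<le> f x"
  shows integrable_lborel_kernel: "integrable (lborel \<Otimes>\<^sub>M lborel) (\<lambda>z. K (snd z - fst z) * f (fst z))"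
    and integral_lborel_kernel: "(\<integral>z. K (snd z - fst z) * f (fst z) \<partial>(lborel \<Otimes>\<^sub>M lborel))
      = integral\<^sup>L lborel K * integral\<^sup>L lborel f"
proof -
  have [measurable]: "K \<in> borel_measurable borel" "f \<in> borel_measurable borel"
    using K f by (auto dest: borel_measurable_integrable)
  note tr = lborel_integral_translate[OF K(1)]
  show *: "integrable (lborel \<Otimes>\<^sub>M lborel) (\<lambda>z. K (snd z - fst z) * f (fst z))"
    by (rule lborel_pair.Fubini_integrable) (auto simp: tr K f)
  show "(\<integral>z. K (snd z - fst z) * f (fst z) \<partial>(lborel \<Otimes>\<^sub>M lborel))
      = integral\<^sup>L lborel K * integral\<^sup>L lborel f"
    by (subst lborel_pair.integral_fst'[OF *, symmetric]) (simp add: tr)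
qed

section \<open>The Fourier integral in the square norm\<close>

definition fourier_int :: "('a::euclidean_space \<Rightarrow> complex ^ 'c) \<Rightarrow> 'a \<Rightarrow> complex ^ 'c" where
  "fourier_int g x = (\<integral>p. exp (\<i> * of_real (p \<bullet> x)) *s g p \<partial>lborel)"

lemma integrable_fourier:
  fixes g :: "'a::euclidean_space \<Rightarrow> complex ^ 'c"
  assumes "integrable lborel g"
  shows "integrable lborel (\<lambda>p. exp (\<i> * of_real (p \<bullet> x)) *s g p)"
  using assms by (rule Bochner_Integration.integrable_bound)
    (use borel_measurable_integrable[OF assms] in \<open>auto simp: norm_vec_scale\<close>)

lemma fourier_int_measurable [measurable]:
  fixes g :: "'a::euclidean_space \<Rightarrow> complex ^ 'c"
  assumes "integrable lborel g"
  shows "fourier_int g \<in> borel_measurable borel"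
proof -
  have [measurable]: "g \<in> borel_measurable borel"
    using borel_measurable_integrable[OF assms] by simp
  show ?thesis unfolding fourier_int_def by measurable
qed

text \<open>
  The weighted integral equals \<open>\<integral>\<integral> K (p - q) \<langle>g p, g q\<rangle>\<close> for the positive kernel
  \<^term>\<open>gauss_hat \<epsilon>\<close> of mass \<open>(2\<pi>)\<^sup>d\<close>; estimate the inner product by AM-GM.
\<close>

lemma gauss_weighted_plancherel:
  fixes g :: "'a::euclidean_space \<Rightarrow> complex ^ 'c"
  assumes g: "integrable lborel g" and g2: "square_integrable g" and \<epsilon>: "0 < \<epsilon>"
  shows "integrable lborel (\<lambda>x. gauss \<epsilon> x * (norm (fourier_int g x))\<^sup>2)"
    and "(\<integral>x. gauss \<epsilon> x * (norm (fourier_int g x))\<^sup>2 \<partial>lborel)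
      \<le> (2 * pi) ^ DIM('a) * (\<integral>p. (norm (g p))\<^sup>2 \<partial>lborel)"
proof -
  have [measurable]: "g \<in> borel_measurable borel"
    using borel_measurable_integrable[OF g] by simp
  have ig2: "integrable lborel (\<lambda>p. (norm (g p))\<^sup>2)"
    using g2 by (simp add: square_integrable_def)
  define \<Phi> where "\<Phi> x z = gauss \<epsilon> x * ((exp (\<i> * of_real ((snd z - fst z) \<bullet> x)) *s g (snd z)) \<bullet> g (fst z))"
    for x :: 'a and z :: "'a \<times> 'a"
  have square: "gauss \<epsilon> x * (norm (fourier_int g x))\<^sup>2 = (\<integral>z. \<Phi> x z \<partial>lborel)" for x
  proof -
    let ?f = "\<lambda>p. exp (\<i> * of_real (p \<bullet> x)) *s g p"
    have eq: "?f (fst z) \<bullet> ?f (snd z)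
        = (exp (\<i> * of_real ((snd z - fst z) \<bullet> x)) *s g (snd z)) \<bullet> g (fst z)" for z
    proof -
      have "?f (fst z) \<bullet> ?f (snd z) = ?f (snd z) \<bullet> ?f (fst z)"
        by (rule inner_commute)
      also have "\<dots> = ((cnj (exp (\<i> * of_real (fst z \<bullet> x))) * exp (\<i> * of_real (snd z \<bullet> x))) *s g (snd z)) \<bullet> g (fst z)"
        by (simp add: inner_vec_scale mult.commute)
      also have "cnj (exp (\<i> * of_real (fst z \<bullet> x))) * exp (\<i> * of_real (snd z \<bullet> x))
          = exp (\<i> * of_real ((snd z - fst z) \<bullet> x))"
        by (simp add: exp_cnj exp_add[symmetric] algebra_simps)
      finally show ?thesis .
    qed
    have "(norm (fourier_int g x))\<^sup>2 = (\<integral>z. ?f (fst z) \<bullet> ?f (snd z) \<partial>(lborel \<Otimes>\<^sub>M lborel))"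
      by (subst integral_lborel_inner_pair[OF integrable_fourier[OF g] integrable_fourier[OF g]])
        (simp add: fourier_int_def power2_norm_eq_inner)
    then show ?thesis
      by (simp add: \<Phi>_def lborel_prod eq)
  qed
  \<comment> \<open>Fubini is applied to the position together with both momenta. The convergence
    factor provides integrability in \<open>x\<close>, and absolute integrability of
    \<open>g\<close> provides it in each momentum.\<close>
  have int: "integrable (lborel \<Otimes>\<^sub>M lborel) (\<lambda>(x, z). \<Phi> x z)"
  proof (rule Bochner_Integration.integrable_bound)
    have "integrable (lborel :: ('a \<times> 'a) measure) (\<lambda>z. norm (g (fst z)) * norm (g (snd z)))"
      using integrable_lborel_mult_pair[OF integrable_norm[OF g] integrable_norm[OF g]]
      by (simp add: lborel_prod)
    then show "integrable (lborel \<Otimes>\<^sub>M lborel)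
        (\<lambda>w. gauss \<epsilon> (fst w) * (norm (g (fst (snd w))) * norm (g (snd (snd w)))))"
      by (rule integrable_lborel_mult_pair[OF integrable_gauss[OF \<epsilon>]])
    show "(\<lambda>(x, z). \<Phi> x z) \<in> borel_measurable (lborel \<Otimes>\<^sub>M lborel)"
      unfolding \<Phi>_def lborel_prod[symmetric, where ?'a = 'a and ?'b = 'a] by measurable
    have "\<bar>(exp (\<i> * of_real r) *s u) \<bullet> v\<bar> \<le> norm v * norm u" for r and u v :: "complex ^ 'c"
      using Cauchy_Schwarz_ineq2[of "exp (\<i> * of_real r) *s u" v]
      by (simp add: norm_vec_scale mult.commute)
    then have "\<bar>\<Phi> x z\<bar> \<le> gauss \<epsilon> x * (norm (g (fst z)) * norm (g (snd z)))" for x z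
      unfolding \<Phi>_def abs_mult abs_of_nonneg[OF gauss_nonneg]
      by (rule mult_left_mono) (rule gauss_nonneg)
    then have "\<bar>\<Phi> x z\<bar> \<le> \<bar>gauss \<epsilon> x * (norm (g (fst z)) * norm (g (snd z)))\<bar>" for x z
      by (rule order_trans[OF _ abs_ge_self])
    then show "AE w in lborel \<Otimes>\<^sub>M lborel. norm (case w of (x, z) \<Rightarrow> \<Phi> x z)
        \<le> norm (gauss \<epsilon> (fst w) * (norm (g (fst (snd w))) * norm (g (snd (snd w)))))"
      unfolding split_beta real_norm_def by (intro always_eventually allI)
  qed
  show "integrable lborel (\<lambda>x. gauss \<epsilon> x * (norm (fourier_int g x))\<^sup>2)"
    unfolding square using lborel_pair.integrable_fst[OF int] by (simp add: split_beta)
  have ghat: "integrable lborel (gauss_hat \<epsilon> :: 'a \<Rightarrow> real)"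
    by (rule integrable_gauss_hat[OF \<epsilon>])
  have inner: "(\<integral>x. \<Phi> x z \<partial>lborel) = gauss_hat \<epsilon> (snd z - fst z) * (g (snd z) \<bullet> g (fst z))" for z
  proof -
    let ?k = "snd z - fst z"
    have "(\<integral>x. \<Phi> x z \<partial>lborel)
        = (\<integral>x. ((of_real (gauss \<epsilon> x) * exp (\<i> * of_real (?k \<bullet> x))) *s g (snd z)) \<bullet> g (fst z) \<partial>lborel)"
      unfolding \<Phi>_def
      by (intro Bochner_Integration.integral_cong)
        (simp_all add: vec_scale_of_real_mult)
    also have "\<dots> = ((\<integral>x. of_real (gauss \<epsilon> x) * exp (\<i> * of_real (?k \<bullet> x)) \<partial>lborel) *s g (snd z)) \<bullet> g (fst z)"
      by (rule integral_bounded_linear[OF _ integrable_fourier_gauss[OF \<epsilon>]])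
        (rule bounded_linear_compose[OF bounded_linear_inner_left bounded_linear_vec_scale_left])
    finally show ?thesis
      unfolding fourier_gauss[OF \<epsilon>] by (simp add: vec_scale_of_real)
  qed
  let ?n = "\<lambda>p. (norm (g p))\<^sup>2"
  \<comment> \<open>Evenness makes the kernel symmetric in the two momenta, so the two halves of the
    AM-GM bound have the same integral.\<close>
  have even: "gauss_hat \<epsilon> (p - q) = gauss_hat \<epsilon> (q - p)" for p q :: 'a
    by (simp add: gauss_hat_def inner_diff_left normal_density_def power2_commute)
  note ker = integrable_lborel_kernel[OF ghat gauss_hat_nonneg ig2 zero_le_power2]
  note kerI = integral_lborel_kernel[OF ghat gauss_hat_nonneg ig2 zero_le_power2]
  have ker': "integrable (lborel \<Otimes>\<^sub>M lborel) (\<lambda>z. gauss_hat \<epsilon> (snd z - fst z) * ?n (snd z))"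
    using lborel_pair.integrable_product_swap[OF ker] by (simp add: even[of "snd _" "fst _"] split_beta')
  have kerI': "(\<integral>z. gauss_hat \<epsilon> (snd z - fst z) * ?n (snd z) \<partial>(lborel \<Otimes>\<^sub>M lborel))
      = integral\<^sup>L lborel (gauss_hat \<epsilon> :: 'a \<Rightarrow> real) * integral\<^sup>L lborel ?n"
    using lborel_pair.integral_product_swap[OF borel_measurable_integrable[OF ker]] kerI
    by (simp add: even[of "snd _" "fst _"] split_beta')
  have "(\<integral>x. gauss \<epsilon> x * (norm (fourier_int g x))\<^sup>2 \<partial>lborel)
      = (\<integral>z. gauss_hat \<epsilon> (snd z - fst z) * (g (snd z) \<bullet> g (fst z)) \<partial>lborel)"
    unfolding square using lborel_pair.Fubini_integral[OF int] by (simp add: inner)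
  also have "\<dots> \<le> (\<integral>z. (gauss_hat \<epsilon> (snd z - fst z) * ?n (fst z)
      + gauss_hat \<epsilon> (snd z - fst z) * ?n (snd z)) / 2 \<partial>(lborel \<Otimes>\<^sub>M lborel))"
    unfolding lborel_prod[symmetric]
  proof (rule integral_mono)
    show "integrable (lborel \<Otimes>\<^sub>M lborel) (\<lambda>z. gauss_hat \<epsilon> (snd z - fst z) * (g (snd z) \<bullet> g (fst z)))"
      using lborel_pair.integrable_snd[OF int] by (simp add: inner lborel_prod)
    show "integrable (lborel \<Otimes>\<^sub>M lborel) (\<lambda>z. (gauss_hat \<epsilon> (snd z - fst z) * ?n (fst z)
      + gauss_hat \<epsilon> (snd z - fst z) * ?n (snd z)) / 2)"
      using ker ker' by simp
    fix z :: "'a \<times> 'a"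
    have "g (snd z) \<bullet> g (fst z) \<le> (?n (fst z) + ?n (snd z)) / 2"
      using norm_cauchy_schwarz[of "g (snd z)" "g (fst z)"]
        sum_squares_bound[of "norm (g (snd z))" "norm (g (fst z))"] by simp
    from mult_left_mono[OF this gauss_hat_nonneg[of \<epsilon> "snd z - fst z"]]
    show "gauss_hat \<epsilon> (snd z - fst z) * (g (snd z) \<bullet> g (fst z))
        \<le> (gauss_hat \<epsilon> (snd z - fst z) * ?n (fst z) + gauss_hat \<epsilon> (snd z - fst z) * ?n (snd z)) / 2"
      by (simp add: algebra_simps)
  qed
  also have "\<dots> = integral\<^sup>L lborel (gauss_hat \<epsilon> :: 'a \<Rightarrow> real) * integral\<^sup>L lborel ?n"
    using ker ker' by (simp add: kerI kerI')
  finally show "(\<integral>x. gauss \<epsilon> x * (norm (fourier_int g x))\<^sup>2 \<partial>lborel)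
      \<le> (2 * pi) ^ DIM('a) * (\<integral>p. (norm (g p))\<^sup>2 \<partial>lborel)"
    by (simp add: integral_gauss_hat[OF \<epsilon>])
qed

text \<open>The weighted bound is uniform in \<open>\<epsilon>\<close>. Fatou's lemma along
  \<open>\<epsilon> = 1 / (n + 1)\<close> removes the weight and gives square-integrability together
  with the estimate.\<close>

lemma fourier_int_l2_bound:
  fixes g :: "'a::euclidean_space \<Rightarrow> complex ^ 'c"
  assumes g: "integrable lborel g" and g2: "square_integrable g"
  shows "square_integrable (fourier_int g)"
    and "(\<integral>x. (norm (fourier_int g x))\<^sup>2 \<partial>lborel)
      \<le> (2 * pi) ^ DIM('a) * (\<integral>p. (norm (g p))\<^sup>2 \<partial>lborel)"
proof -
  note [measurable] = fourier_int_measurable[OF g]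
  define C where "C = (2 * pi) ^ DIM('a) * (\<integral>p. (norm (g p))\<^sup>2 \<partial>lborel)"
  have C: "0 \<le> C" by (simp add: C_def)
  let ?u = "\<lambda>n x. gauss (1 / Suc n) x * (norm (fourier_int g x))\<^sup>2"
  have nn: "0 \<le> ?u n x" for n x by (simp add: gauss_nonneg)
  have conv: "(\<lambda>n. ?u n x) \<longlonglongrightarrow> (norm (fourier_int g x))\<^sup>2" for x
  proof -
    have "(\<lambda>n. gauss (1 / Suc n) x) \<longlonglongrightarrow> (\<Prod>b\<in>Basis. exp (- (0 * (x \<bullet> b))\<^sup>2 / 2))"
      unfolding gauss_def using LIMSEQ_inverse_real_of_nat by (intro tendsto_intros) (simp_all add: inverse_eq_divide)
    from tendsto_mult[OF this tendsto_const[of "(norm (fourier_int g x))\<^sup>2"]]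
    show ?thesis by simp
  qed
  have "(\<integral>\<^sup>+x. ennreal ((norm (fourier_int g x))\<^sup>2) \<partial>lborel)
      = (\<integral>\<^sup>+x. liminf (\<lambda>n. ennreal (?u n x)) \<partial>lborel)"
    by (intro nn_integral_cong, subst lim_imp_Liminf[OF _ tendsto_ennrealI[OF conv]]) simp_all
  also have "\<dots> \<le> liminf (\<lambda>n. \<integral>\<^sup>+x. ennreal (?u n x) \<partial>lborel)"
    by (rule nn_integral_liminf) simp
  also have "\<dots> \<le> liminf (\<lambda>n. ennreal C)"
  proof (intro Liminf_mono always_eventually allI)
    fix n
    have "(\<integral>\<^sup>+x. ennreal (?u n x) \<partial>lborel) = ennreal (\<integral>x. ?u n x \<partial>lborel)"
      by (rule nn_integral_eq_integral[OF gauss_weighted_plancherel(1)[OF g g2] AE_I2[OF nn]]) simp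
    also have "\<dots> \<le> ennreal C"
      unfolding C_def by (intro ennreal_leI gauss_weighted_plancherel(2)[OF g g2]) simp
    finally show "(\<integral>\<^sup>+x. ennreal (?u n x) \<partial>lborel) \<le> ennreal C" .
  qed
  finally have le: "(\<integral>\<^sup>+x. ennreal ((norm (fourier_int g x))\<^sup>2) \<partial>lborel) \<le> ennreal C"
    by (simp add: Liminf_const)
  then have int: "integrable lborel (\<lambda>x. (norm (fourier_int g x))\<^sup>2)"
    by (intro integrableI_nonneg) (auto simp: less_top[symmetric] top_unique intro: le_less_trans)
  then show "square_integrable (fourier_int g)"
    by (simp add: square_integrable_def fourier_int_measurable[OF g])
  have "ennreal (\<integral>x. (norm (fourier_int g x))\<^sup>2 \<partial>lborel) \<le> ennreal C"
    using le by (subst (asm) nn_integral_eq_integral[OF int]) simp_all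
  then show "(\<integral>x. (norm (fourier_int g x))\<^sup>2 \<partial>lborel)
      \<le> (2 * pi) ^ DIM('a) * (\<integral>p. (norm (g p))\<^sup>2 \<partial>lborel)"
    using C by (simp add: C_def)
qed

section \<open>Band-limited functions\<close>

definition band :: "real \<Rightarrow> (real ^ 'd \<Rightarrow> complex ^ 'c) set" where
  "band \<Lambda> = {g. square_integrable g \<and> (\<forall>p. (\<exists>b. \<bar>p $ b\<bar> > \<Lambda>) \<longrightarrow> g p = 0)}"

definition inv_fourier :: "(real ^ 'd \<Rightarrow> complex ^ 'c) \<Rightarrow> ('d::finite, 'c::finite) l2" where
  "inv_fourier g = abs_l2 (\<lambda>x. (1 / sqrt ((2 * pi) ^ CARD('d))) *\<^sub>R fourier_int g x)"

text \<open>Momentum space is kept at the level of functions instead of classes in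
  \<open>l2\<close>, so that vanishing outside the cube can be required pointwise. The norm is
  therefore defined anew for functions.\<close>

definition l2_size :: "('a::euclidean_space \<Rightarrow> 'b::euclidean_space) \<Rightarrow> real" where
  "l2_size g = sqrt (\<integral>p. (norm (g p))\<^sup>2 \<partial>lborel)"

lemma l2_size_le:
  assumes "square_integrable f" "square_integrable g" "\<And>p. norm (g p) \<le> k * norm (f p)" "0 \<le> k"
  shows "l2_size g \<le> k * l2_size f"
proof -
  have "(\<integral>p. (norm (g p))\<^sup>2 \<partial>lborel) \<le> (\<integral>p. k\<^sup>2 * (norm (f p))\<^sup>2 \<partial>lborel)"
  proof (rule integral_mono)
    show "(norm (g p))\<^sup>2 \<le> k\<^sup>2 * (norm (f p))\<^sup>2" for p
      using power_mono[OF assms(3)[of p], of 2] by (simp add: power_mult_distrib)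
  qed (use assms in \<open>auto simp: square_integrable_def\<close>)
  then have "(\<integral>p. (norm (g p))\<^sup>2 \<partial>lborel) \<le> k\<^sup>2 * (\<integral>p. (norm (f p))\<^sup>2 \<partial>lborel)"
    by simp
  from real_sqrt_le_mono[OF this] show ?thesis
    using assms(4) by (simp add: l2_size_def real_sqrt_mult)
qed

lemma band_square_integrable: "g \<in> band \<Lambda> \<Longrightarrow> square_integrable g"
  by (simp add: band_def)

lemma band_measurable: "g \<in> band \<Lambda> \<Longrightarrow> g \<in> borel_measurable borel"
  by (simp add: band_def square_integrable_def)

lemma band_eq_0: "g \<in> band \<Lambda> \<Longrightarrow> \<Lambda> < \<bar>p $ b\<bar> \<Longrightarrow> g p = 0"
  unfolding band_def by blast

lemma band_boundedI:
  assumes "g \<in> band \<Lambda>" "f \<in> borel_measurable borel" "\<And>p. norm (f p) \<le> k * norm (g p)"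
  shows "f \<in> band \<Lambda>"
proof -
  have "f p = 0" if "\<exists>b. \<bar>p $ b\<bar> > \<Lambda>" for p
    using assms(3)[of p] assms(1) that by (auto simp: band_def)
  then show ?thesis
    using square_integrable_bounded[OF band_square_integrable[OF assms(1)] _ assms(3)] assms(2)
    by (simp add: band_def)
qed

lemma band_linear: "g \<in> band \<Lambda> \<Longrightarrow> bounded_linear T \<Longrightarrow> (\<lambda>p. T (g p)) \<in> band \<Lambda>"
  by (auto simp: band_def square_integrable_linear linear_simps)

lemma band_add: "f \<in> band \<Lambda> \<Longrightarrow> g \<in> band \<Lambda> \<Longrightarrow> (\<lambda>p. f p + g p) \<in> band \<Lambda>"
  by (auto simp: band_def square_integrable_add)

lemma band_diff: "f \<in> band \<Lambda> \<Longrightarrow> g \<in> band \<Lambda> \<Longrightarrow> (\<lambda>p. f p - g p) \<in> band \<Lambda>"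
  by (auto simp: band_def square_integrable_diff)

lemma band_scaleR: "g \<in> band \<Lambda> \<Longrightarrow> (\<lambda>p. r *\<^sub>R g p) \<in> band \<Lambda>"
  by (rule band_linear[OF _ bounded_linear_scaleR_right])

lemma band_zero: "(\<lambda>p. 0) \<in> band \<Lambda>"
  by (simp add: band_def square_integrable_zero)

text \<open>Since \<open>r \<le> 1 + r * r\<close> for every real \<open>r\<close>, the norm of
  \<open>g\<close> is dominated by its square plus the indicator of the cube, which has finite
  volume.\<close>

lemma band_integrable:
  fixes g :: "real ^ 'd \<Rightarrow> complex ^ 'c"
  assumes "g \<in> band \<Lambda>"
  shows "integrable lborel g"
proof -
  let ?Q = "cbox (\<chi> i. - \<Lambda>) (\<chi> i. \<Lambda>) :: (real ^ 'd) set"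
  have "integrable lborel (indicator ?Q :: real ^ 'd \<Rightarrow> real)"
    using emeasure_lborel_cbox_finite by (intro integrable_real_indicator) simp_all
  then have "integrable lborel (\<lambda>p. indicator ?Q p + (norm (g p))\<^sup>2)"
    using band_square_integrable[OF assms] by (simp add: square_integrable_def)
  then show ?thesis
  proof (rule Bochner_Integration.integrable_bound)
    show "g \<in> borel_measurable lborel"
      using band_measurable[OF assms] by simp
    have "norm (g p) \<le> indicator ?Q p + (norm (g p))\<^sup>2" for p
    proof (cases "p \<in> ?Q")
      case True
      have "norm (g p) \<le> 1 + (norm (g p))\<^sup>2"
        using sum_squares_bound[of 1 "norm (g p)"] norm_ge_zero[of "g p"] by (simp add: del: norm_ge_zero)
      with True show ?thesis by simp
    next
      case False
      then have "\<exists>b. \<not> (- \<Lambda> \<le> p $ b \<and> p $ b \<le> \<Lambda>)"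
        by (auto simp: mem_box_cart)
      moreover have "\<bar>r\<bar> > \<Lambda> \<longleftrightarrow> \<not> (- \<Lambda> \<le> r \<and> r \<le> \<Lambda>)" for r
        by linarith
      ultimately have "\<exists>b. \<bar>p $ b\<bar> > \<Lambda>" by simp
      then have "g p = 0" using assms by (simp add: band_def)
      then show ?thesis by simp
    qed
    then show "AE p in lborel. norm (g p) \<le> norm (indicator ?Q p + (norm (g p))\<^sup>2)"
      by simp
  qed
qed

abbreviation inv_fourier_repr :: "(real ^ 'd \<Rightarrow> complex ^ 'c) \<Rightarrow> real ^ 'd \<Rightarrow> complex ^ 'c" where
  "inv_fourier_repr g x \<equiv> (1 / sqrt ((2 * pi) ^ CARD('d))) *\<^sub>R fourier_int g x"

lemma square_integrable_inv_fourier: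
  "g \<in> band \<Lambda> \<Longrightarrow> square_integrable (inv_fourier_repr g)"
  by (intro square_integrable_scaleR fourier_int_l2_bound(1) band_integrable band_square_integrable)

lemma l2_rel_inv_fourier:
  "g \<in> band \<Lambda> \<Longrightarrow> l2_rel (inv_fourier_repr g) (inv_fourier_repr g)"
  unfolding l2_rel_def by (intro conjI square_integrable_inv_fourier AE_I2 refl)

lemma norm_inv_fourier_le:
  fixes g :: "real ^ 'd \<Rightarrow> complex ^ 'c"
  assumes "g \<in> band \<Lambda>"
  shows "norm (inv_fourier g) \<le> l2_size g"
proof -
  define c where "c = (2 * pi) ^ CARD('d)"
  have c: "0 < c" by (simp add: c_def)
  have "inner (inv_fourier g) (inv_fourier g) = (\<integral>x. inverse c * (norm (fourier_int g x))\<^sup>2 \<partial>lborel)"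
    unfolding inv_fourier_def inner_l2.abs_eq[OF l2_rel_inv_fourier[OF assms] l2_rel_inv_fourier[OF assms]]
    unfolding c_def[symmetric] using c
    by (intro Bochner_Integration.integral_cong)
      (simp_all add: power2_norm_eq_inner real_sqrt_mult_self field_simps)
  also have "\<dots> = inverse c * (\<integral>x. (norm (fourier_int g x))\<^sup>2 \<partial>lborel)"
    by simp
  also have "\<dots> \<le> inverse c * (c * (\<integral>p. (norm (g p))\<^sup>2 \<partial>lborel))"
    using fourier_int_l2_bound(2)[OF band_integrable[OF assms] band_square_integrable[OF assms]]
    using c by (intro mult_left_mono) (simp_all add: c_def)
  also have "\<dots> = (\<integral>p. (norm (g p))\<^sup>2 \<partial>lborel)"
    using c by simp
  finally show ?thesis
    unfolding norm_eq_sqrt_inner[of "inv_fourier g"] l2_size_def by (rule real_sqrt_le_mono)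
qed

lemma inv_fourier_add:
  assumes "f \<in> band \<Lambda>" "g \<in> band \<Lambda>"
  shows "inv_fourier (\<lambda>p. f p + g p) = inv_fourier f + inv_fourier g"
proof -
  have "fourier_int (\<lambda>p. f p + g p) x = fourier_int f x + fourier_int g x" for x
    unfolding fourier_int_def using integrable_fourier assms[THEN band_integrable]
    by (subst Bochner_Integration.integral_add[symmetric]) (simp_all add: vector_add_ldistrib)
  then show ?thesis
    unfolding inv_fourier_def
    by (subst plus_l2.abs_eq[OF l2_rel_inv_fourier l2_rel_inv_fourier])
      (use assms in \<open>auto simp: scaleR_add_right\<close>)
qed

lemma fourier_int_linear:
  assumes "g \<in> band \<Lambda>" "bounded_linear T" "\<And>c v. T (c *s v) = c *s T v"
  shows "fourier_int (\<lambda>p. T (g p)) x = T (fourier_int g x)"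
  unfolding fourier_int_def
  using integral_bounded_linear[OF assms(2) integrable_fourier[OF band_integrable[OF assms(1)]]]
  by (simp add: assms(3))

lemma vec_scale_scaleR: "c *s (r *\<^sub>R v) = r *\<^sub>R (c *s v)" for v :: "complex ^ 'c"
  by (simp add: vec_eq_iff)

lemma inv_fourier_scaleR:
  assumes "g \<in> band \<Lambda>"
  shows "inv_fourier (\<lambda>p. r *\<^sub>R g p) = r *\<^sub>R inv_fourier g"
  unfolding inv_fourier_def
  by (subst scaleR_l2.abs_eq[OF l2_rel_inv_fourier[OF assms]],
      subst fourier_int_linear[OF assms bounded_linear_scaleR_right])
    (simp_all add: vec_eq_iff)

lemma inv_fourier_cscale:
  assumes "g \<in> band \<Lambda>"
  shows "inv_fourier (\<lambda>p. c *s g p) = c *\<^sub>C inv_fourier g"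
  unfolding inv_fourier_def
  by (subst cscale.abs_eq[OF l2_rel_inv_fourier[OF assms]],
      subst fourier_int_linear[OF assms bounded_linear_vec_complex_scale])
    (simp_all add: vec_scale_scaleR)

lemma complex_matrix_vec_scale: "B *v (c *s v) = c *s (B *v v)" for B :: "complex ^ 'c ^ 'c"
  by (simp add: vec_eq_iff matrix_vector_mult_def sum_distrib_left mult_ac)

lemma inv_fourier_internal:
  assumes "g \<in> band \<Lambda>"
  shows "inv_fourier (\<lambda>p. B *v g p) = internal B (inv_fourier g)"
  unfolding inv_fourier_def
  by (subst internal.abs_eq[OF l2_rel_inv_fourier[OF assms]],
      subst fourier_int_linear[OF assms bounded_linear_complex_matrix])
    (simp_all add: linear_cmul[OF bounded_linear.linear[OF bounded_linear_complex_matrix]] complex_matrix_vec_scale)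

lemma inv_fourier_diff:
  assumes "f \<in> band \<Lambda>" "g \<in> band \<Lambda>"
  shows "inv_fourier (\<lambda>p. f p - g p) = inv_fourier f - inv_fourier g"
  using inv_fourier_add[OF assms(1) band_scaleR[OF assms(2)], of "-1"]
  by (simp add: inv_fourier_scaleR[OF assms(2), of "-1", simplified])

lemma inv_fourier_zero: "inv_fourier (\<lambda>p. 0) = 0"
  using inv_fourier_scaleR[OF band_zero, of 0] by simp

lemma inv_fourier_translate:
  assumes "g \<in> band \<Lambda>"
  shows "translate h (inv_fourier g) = inv_fourier (\<lambda>p. exp (\<i> * of_real (p \<bullet> h)) *s g p)"
  unfolding inv_fourier_def
  by (subst translate.abs_eq[OF l2_rel_inv_fourier[OF assms]])
    (simp add: fourier_int_def inner_add_right distrib_left exp_add mult.commute)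

lemma cutoff_states_eq:
  "(cutoff_states \<Lambda> :: ('d::finite, 'c::finite) l2 set) = inv_fourier ` band \<Lambda>"
proof (intro set_eqI iffI)
  fix \<psi> :: "('d::finite, 'c::finite) l2"
  assume "\<psi> \<in> cutoff_states \<Lambda>"
  then obtain g where g: "g \<in> band \<Lambda>" and ae: "AE x in lborel. rep_l2 \<psi> x = inv_fourier_repr g x"
    unfolding cutoff_states_def band_def fourier_int_def by blast
  have "l2_rel (rep_l2 \<psi>) (rep_l2 \<psi>)"
    using Quotient_rel_rep[OF Quotient_l2, of \<psi> \<psi>] by simp
  with ae have "l2_rel (rep_l2 \<psi>) (inv_fourier_repr g)"
    using square_integrable_inv_fourier[OF g] unfolding l2_rel_def by blast
  then have "abs_l2 (rep_l2 \<psi>) = inv_fourier g"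
    unfolding inv_fourier_def by (rule Quotient_rel_abs[OF Quotient_l2])
  then have "\<psi> = inv_fourier g"
    by (simp add: Quotient_abs_rep[OF Quotient_l2])
  with g show "\<psi> \<in> inv_fourier ` band \<Lambda>" by blast
next
  fix \<psi> :: "('d::finite, 'c::finite) l2"
  assume "\<psi> \<in> inv_fourier ` band \<Lambda>"
  then obtain g where g: "g \<in> band \<Lambda>" "\<psi> = inv_fourier g" by blast
  have "l2_rel (rep_l2 \<psi>) (inv_fourier_repr g)"
    unfolding inv_fourier_def g(2)
    by (rule Quotient_rep_abs[OF Quotient_l2]) (rule l2_rel_inv_fourier[OF g(1)])
  then have "AE x in lborel. rep_l2 \<psi> x = inv_fourier_repr g x"
    unfolding l2_rel_def by blast
  with g(1) show "\<psi> \<in> cutoff_states \<Lambda>"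
    unfolding cutoff_states_def band_def fourier_int_def by blast
qed

lemma subspace_cutoff_states: "subspace (cutoff_states \<Lambda> :: ('a::finite, 'b::finite) l2 set)"
proof (rule subspaceI)
  show "0 \<in> cutoff_states \<Lambda>"
    unfolding cutoff_states_eq using inv_fourier_zero band_zero by (metis image_eqI)
next
  fix \<psi> \<phi> :: "('a, 'b) l2"
  assume "\<psi> \<in> cutoff_states \<Lambda>" "\<phi> \<in> cutoff_states \<Lambda>"
  then obtain f g where fg: "f \<in> band \<Lambda>" "\<psi> = inv_fourier f" "g \<in> band \<Lambda>" "\<phi> = inv_fourier g"
    unfolding cutoff_states_eq by blast
  show "\<psi> + \<phi> \<in> cutoff_states \<Lambda>"
    unfolding cutoff_states_eq fg(2,4)
    by (intro image_eqI, rule inv_fourier_add[OF fg(1,3), symmetric], rule band_add[OF fg(1,3)])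
next
  fix r and \<psi> :: "('a, 'b) l2"
  assume "\<psi> \<in> cutoff_states \<Lambda>"
  then obtain f where f: "f \<in> band \<Lambda>" "\<psi> = inv_fourier f"
    unfolding cutoff_states_eq by blast
  show "r *\<^sub>R \<psi> \<in> cutoff_states \<Lambda>"
    unfolding cutoff_states_eq f(2)
    by (intro image_eqI, rule inv_fourier_scaleR[OF f(1), symmetric], rule band_scaleR[OF f(1)])
qed

lemma has_vector_derivative_if_quadratic_bound:
  fixes f :: "real \<Rightarrow> 'a::real_normed_vector"
  assumes "\<And>h. norm (f (s + h) - f s - h *\<^sub>R D) \<le> C * h\<^sup>2"
  shows "(f has_vector_derivative D) (at s)"
  unfolding has_vector_derivative_def has_derivative_at
proof (intro conjI bounded_linear_scaleR_left)
  show "(\<lambda>h. norm (f (s + h) - f s - h *\<^sub>R D) / norm h) \<midarrow>0\<rightarrow> 0"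
  proof (rule tendsto_sandwich[where f = "\<lambda>_. 0" and h = "\<lambda>h. C * \<bar>h\<bar>"])
    show "(\<lambda>h. C * \<bar>h\<bar>) \<midarrow>0\<rightarrow> 0"
      by (rule tendsto_eq_intros refl)+ simp
    show "\<forall>\<^sub>F h in at 0. norm (f (s + h) - f s - h *\<^sub>R D) / norm h \<le> C * \<bar>h\<bar>"
    proof (rule always_eventually, rule allI)
      fix h :: real
      show "norm (f (s + h) - f s - h *\<^sub>R D) / norm h \<le> C * \<bar>h\<bar>"
        using assms[of h] by (cases "h = 0") (simp_all add: divide_le_eq power2_eq_square mult.assoc)
    qed
  qed simp_all
qed

text \<open>A quadratic remainder that is dominated at every momentum by one fixed \<open>g\<close>
  becomes a quadratic remainder in the Hilbert space norm. The action of momentum on cutoff states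
  and the time derivative of the flows are both obtained this way.\<close>

lemma inv_fourier_has_vector_derivative:
  assumes "\<And>s. u s \<in> band \<Lambda>" "u' \<in> band \<Lambda>" "g \<in> band \<Lambda>" "0 \<le> C"
    and "\<And>p h. norm (u (s + h) p - u s p - h *\<^sub>R u' p) \<le> C * h\<^sup>2 * norm (g p)"
  shows "((\<lambda>s. inv_fourier (u s)) has_vector_derivative inv_fourier u') (at s)"
proof (rule has_vector_derivative_if_quadratic_bound)
  fix h
  have in_band: "(\<lambda>p. u (s + h) p - u s p - h *\<^sub>R u' p) \<in> band \<Lambda>"
    by (intro band_diff band_scaleR assms)
  have "inv_fourier (u (s + h)) - inv_fourier (u s) - h *\<^sub>R inv_fourier u'
      = inv_fourier (\<lambda>p. u (s + h) p - u s p - h *\<^sub>R u' p)"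
    by (simp only: inv_fourier_diff[OF band_diff[OF assms(1) assms(1)] band_scaleR[OF assms(2)]]
        inv_fourier_diff[OF assms(1) assms(1)] inv_fourier_scaleR[OF assms(2)])
  also have "norm \<dots> \<le> l2_size (\<lambda>p. u (s + h) p - u s p - h *\<^sub>R u' p)"
    by (rule norm_inv_fourier_le[OF in_band])
  also have "\<dots> \<le> (C * h\<^sup>2) * l2_size g"
    by (rule l2_size_le) (use assms in_band in \<open>auto simp: band_square_integrable\<close>)
  finally show "norm (inv_fourier (u (s + h)) - inv_fourier (u s) - h *\<^sub>R inv_fourier u')
      \<le> (C * l2_size g) * h\<^sup>2"
    by (simp add: mult_ac)
qed

section \<open>Symmetric operators and their propagators\<close>

lemma cscale_add_right: "c *\<^sub>C (x + y) = c *\<^sub>C x + c *\<^sub>C y"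
  by transfer (auto simp: l2_rel_def vector_add_ldistrib
      intro!: square_integrable_add square_integrable_vec_complex_scale)

lemma cscale_cscale: "c *\<^sub>C (d *\<^sub>C x) = (c * d) *\<^sub>C x"
  by transfer (auto simp: l2_rel_def vector_smult_assoc intro!: square_integrable_vec_complex_scale)

lemma cscale_scaleR: "c *\<^sub>C (r *\<^sub>R x) = r *\<^sub>R (c *\<^sub>C x)"
  by transfer (auto simp: l2_rel_def vec_scale_scaleR
      intro!: square_integrable_scaleR square_integrable_vec_complex_scale)

lemma cscale_minus_left: "(- c) *\<^sub>C x = - (c *\<^sub>C x)"
  by transfer (auto simp: l2_rel_def vec_eq_iff
      intro!: square_integrable_minus square_integrable_vec_complex_scale)

lemma cscale_minus_right: "c *\<^sub>C (- x) = - (c *\<^sub>C x)"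
  using cscale_scaleR[of c "-1" x] by simp

lemma cscale_diff_right: "c *\<^sub>C (x - y) = c *\<^sub>C x - c *\<^sub>C y"
  using cscale_add_right[of c x "- y"] by (simp add: cscale_minus_right)

lemma cscale_zero_right: "c *\<^sub>C 0 = 0"
  using cscale_scaleR[of c 0 0] by simp

lemma cscale_sum_right: "c *\<^sub>C (\<Sum>i\<in>I. f i) = (\<Sum>i\<in>I. c *\<^sub>C f i)"
  by (induction I rule: infinite_finite_induct) (simp_all add: cscale_zero_right cscale_add_right)

lemma inner_cscale: "inner (c *\<^sub>C x) y = inner x (cnj c *\<^sub>C y)"
  by transfer (simp add: inner_vec_scale)

lemma norm_cscale: "norm (c *\<^sub>C x) = norm c * norm x"
proof -
  have "inner (c *\<^sub>C x) (c *\<^sub>C x) = inner x (of_real ((norm c)\<^sup>2) *\<^sub>C x)"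
    by (simp add: inner_cscale cscale_cscale mult.commute flip: complex_norm_square)
  also have "of_real r *\<^sub>C x = r *\<^sub>R x" for r
    by transfer (auto simp: l2_rel_def vec_scale_of_real intro!: square_integrable_scaleR)
  finally show ?thesis
    by (simp add: norm_eq_sqrt_inner real_sqrt_mult)
qed

lemma bounded_linear_cscale: "bounded_linear (\<lambda>x. c *\<^sub>C x)"
  by (rule bounded_linear_intro[where K = "norm c"])
    (simp_all add: cscale_add_right cscale_scaleR norm_cscale mult.commute)

lemma internal_diff: "internal B (x - y) = internal B x - internal B y"
  by transfer (auto simp: l2_rel_def matrix_vector_mult_diff_distrib
      intro!: square_integrable_diff square_integrable_complex_matrix)

lemma internal_cscale: "internal B (c *\<^sub>C x) = c *\<^sub>C internal B x"
  by transfer (auto simp: l2_rel_def complex_matrix_vec_scale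
      intro!: square_integrable_vec_complex_scale square_integrable_complex_matrix)

lemma inner_hermitian:
  assumes "hermitian B"
  shows "(B *v u) \<bullet> v = u \<bullet> (B *v v)"
proof -
  have inner: "x \<bullet> y = Re (\<Sum>i\<in>UNIV. x $ i * cnj (y $ i))" for x y :: "complex ^ 'a"
    by (simp add: inner_vec_def inner_complex_def)
  have "(\<Sum>i\<in>UNIV. (B *v u) $ i * cnj (v $ i)) = (\<Sum>i\<in>UNIV. \<Sum>j\<in>UNIV. B $ i $ j * u $ j * cnj (v $ i))"
    by (simp only: matrix_vector_mult_def vec_lambda_beta sum_distrib_right)
  also have "\<dots> = (\<Sum>i\<in>UNIV. \<Sum>j\<in>UNIV. B $ j $ i * u $ i * cnj (v $ j))"
    by (rule sum.swap)
  also have "\<dots> = (\<Sum>i\<in>UNIV. \<Sum>j\<in>UNIV. u $ i * cnj (B $ i $ j * v $ j))"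
  proof (intro sum.cong refl)
    fix i j
    have "cnj (B $ i $ j) = B $ j $ i"
      using assms by (metis hermitian_def)
    then show "B $ j $ i * u $ i * cnj (v $ j) = u $ i * cnj (B $ i $ j * v $ j)"
      by (simp only: complex_cnj_mult mult_ac)
  qed
  also have "\<dots> = (\<Sum>i\<in>UNIV. u $ i * cnj ((B *v v) $ i))"
    by (simp only: matrix_vector_mult_def vec_lambda_beta cnj_sum sum_distrib_left)
  finally show ?thesis by (simp only: inner)
qed

lemma inner_internal: "hermitian B \<Longrightarrow> inner (internal B x) y = inner x (internal B y)"
  by transfer (simp add: inner_hermitian)

lemma translate_diff: "translate h (x - y) = translate h x - translate h y"
  by transfer (auto simp: l2_rel_def intro!: square_integrable_translate square_integrable_diff)

lemma translate_cscale: "translate h (c *\<^sub>C x) = c *\<^sub>C translate h x"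
  by transfer (auto simp: l2_rel_def
      intro!: square_integrable_translate square_integrable_vec_complex_scale)

lemma translate_internal: "translate h (internal B x) = internal B (translate h x)"
  by transfer (auto simp: l2_rel_def
      intro!: square_integrable_translate square_integrable_complex_matrix)

lemma inner_translate: "inner (translate h x) y = inner x (translate (- h) y)"
proof transfer
  fix h and f g :: "real ^ 'a \<Rightarrow> complex ^ 'b"
  assume "l2_rel f f" "l2_rel g g"
  then have "integrable lborel (\<lambda>x. f (x + h) \<bullet> g x)"
    by (intro square_integrable_inner square_integrable_translate) (auto simp: l2_rel_def)
  from lborel_integral_translate(2)[OF this, of h]
  show "(\<integral>x. f (x + h) \<bullet> g x \<partial>lborel) = (\<integral>x. f x \<bullet> g (x + - h) \<partial>lborel)"
    by simp
qed

section \<open>Symmetric operators and uniqueness of solutions\<close>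

text \<open>\<open>inner\<close> is only the real part of the complex inner product, so symmetry is
  demanded with an arbitrary complex factor \<open>c\<close>; the choice \<open>c = - \<i>\<close>
  makes \<open>- \<i> A\<close> skew. Closure under differences is the part of linearity that lets
  two solutions be subtracted.\<close>

definition symmetric_operator :: "('d::finite, 'c::finite) operator \<Rightarrow> bool" where
  "symmetric_operator A \<longleftrightarrow> single_valued A \<and>
     (\<forall>\<psi> \<phi> \<psi>' \<phi>'. (\<psi>, \<phi>) \<in> A \<longrightarrow> (\<psi>', \<phi>') \<in> A \<longrightarrow>
        (\<psi> - \<psi>', \<phi> - \<phi>') \<in> A \<and> (\<forall>c. inner (c *\<^sub>C \<phi>) \<psi>' = inner (c *\<^sub>C \<psi>) \<phi>'))"

lemma symmetric_operatorD:
  assumes "symmetric_operator A" "(\<psi>, \<phi>) \<in> A" "(\<psi>', \<phi>') \<in> A"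
  shows "(\<psi> - \<psi>', \<phi> - \<phi>') \<in> A" "inner (c *\<^sub>C \<phi>) \<psi>' = inner (c *\<^sub>C \<psi>) \<phi>'"
    and "inner (- \<i> *\<^sub>C \<phi>) \<psi>' = - inner \<psi> (- \<i> *\<^sub>C \<phi>')"
proof -
  show *: "(\<psi> - \<psi>', \<phi> - \<phi>') \<in> A" "inner (c *\<^sub>C \<phi>) \<psi>' = inner (c *\<^sub>C \<psi>) \<phi>'" for c
    using assms unfolding symmetric_operator_def by blast+
  show "inner (- \<i> *\<^sub>C \<phi>) \<psi>' = - inner \<psi> (- \<i> *\<^sub>C \<phi>')"
    using *(2)[of "- \<i>"] by (simp add: inner_cscale cscale_minus_left)
qed

lemma symmetric_operator_skew:
  assumes "symmetric_operator A" "(\<psi>, \<phi>) \<in> A"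
  shows "inner (- \<i> *\<^sub>C \<phi>) \<psi> = 0"
  using symmetric_operatorD(3)[OF assms assms(2)] by (simp add: inner_commute)

lemma symmetric_constant_term: "hermitian B \<Longrightarrow> symmetric_operator (constant_term B)"
  unfolding symmetric_operator_def constant_term_def single_valued_def
  by (auto simp: internal_diff inner_internal internal_cscale[symmetric])

text \<open>The adjoint of a translation is the opposite translation, and translations commute with
  \<open>B\<close>. Hence one scalar function of the shift \<open>h\<close> can be differentiated at
  0 in either argument, and the two derivatives must agree. Only \<open>internal B \<psi>\<close> is
  known to be differentiable, so \<open>B\<close> changes sides together with the
  translation.\<close>

lemma symmetric_linear_term:
  assumes "hermitian B"
  shows "symmetric_operator (linear_term B b)"
  unfolding symmetric_operator_def
proof (intro conjI allI impI)
  let ?T = "\<lambda>h. translate (h *\<^sub>R axis b 1) :: ('b, 'a) l2 \<Rightarrow> ('b, 'a) l2"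
  have ex: "\<exists>\<eta>. \<phi> = - \<i> *\<^sub>C \<eta> \<and> ((\<lambda>h. ?T h (internal B \<psi>)) has_vector_derivative \<eta>) (at 0)"
    if "(\<psi>, \<phi>) \<in> linear_term B b" for \<psi> \<phi>
    using that by (auto simp: linear_term_def momentum_def)
  show "single_valued (linear_term B b)"
  proof (rule single_valuedI)
    fix \<psi> \<phi> \<phi>'
    assume "(\<psi>, \<phi>) \<in> linear_term B b" "(\<psi>, \<phi>') \<in> linear_term B b"
    from this[THEN ex] obtain \<eta> \<eta>' where
      "\<phi> = - \<i> *\<^sub>C \<eta>" "((\<lambda>h. ?T h (internal B \<psi>)) has_vector_derivative \<eta>) (at 0)"
      "\<phi>' = - \<i> *\<^sub>C \<eta>'" "((\<lambda>h. ?T h (internal B \<psi>)) has_vector_derivative \<eta>') (at 0)"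
      by blast
    then show "\<phi> = \<phi>'"
      using vector_derivative_unique_at[of "\<lambda>h. ?T h (internal B \<psi>)" \<eta> 0 \<eta>'] by simp
  qed
  fix \<psi> \<phi> \<psi>' \<phi>'
  assume \<psi>: "(\<psi>, \<phi>) \<in> linear_term B b" and \<psi>': "(\<psi>', \<phi>') \<in> linear_term B b"
  from ex[OF \<psi>] obtain \<eta> where \<eta>: "\<phi> = - \<i> *\<^sub>C \<eta>"
    "((\<lambda>h. ?T h (internal B \<psi>)) has_vector_derivative \<eta>) (at 0)" by blast
  from ex[OF \<psi>'] obtain \<eta>' where \<eta>': "\<phi>' = - \<i> *\<^sub>C \<eta>'"
    "((\<lambda>h. ?T h (internal B \<psi>')) has_vector_derivative \<eta>') (at 0)" by blast
  have "((\<lambda>h. ?T h (internal B (\<psi> - \<psi>'))) has_vector_derivative \<eta> - \<eta>') (at 0)"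
    unfolding internal_diff translate_diff using \<eta>(2) \<eta>'(2) by (rule has_vector_derivative_diff)
  moreover have "\<phi> - \<phi>' = - \<i> *\<^sub>C (\<eta> - \<eta>')"
    by (simp add: \<eta> \<eta>' cscale_diff_right)
  ultimately show "(\<psi> - \<psi>', \<phi> - \<phi>') \<in> linear_term B b"
    unfolding linear_term_def momentum_def by blast
  fix c
  define f where "f h = inner ((- \<i> * c) *\<^sub>C ?T h (internal B \<psi>)) \<psi>'" for h
  have "(f has_vector_derivative inner ((- \<i> * c) *\<^sub>C \<eta>) \<psi>') (at 0)"
    unfolding f_def
    by (intro bounded_linear.has_vector_derivative[OF
          bounded_linear_compose[OF bounded_linear_inner_left bounded_linear_cscale]] \<eta>(2))
  moreover have "(f has_vector_derivative - inner (c *\<^sub>C \<psi>) (\<i> *\<^sub>C \<eta>')) (at 0)"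
  proof -
    have eq: "f h = inner (c *\<^sub>C \<psi>) (\<i> *\<^sub>C ?T (- h) (internal B \<psi>'))" for h
    proof -
      have "f h = inner \<psi> ((cnj c * \<i>) *\<^sub>C ?T (- h) (internal B \<psi>'))"
        unfolding f_def
        by (simp add: inner_cscale inner_translate inner_internal[OF assms] internal_cscale
            translate_cscale translate_internal mult.commute)
      then show ?thesis by (simp add: inner_cscale cscale_cscale)
    qed
    have "((\<lambda>h. ?T (- h) (internal B \<psi>')) has_vector_derivative (-1) *\<^sub>R \<eta>') (at 0)"
    proof -
      have "(uminus has_vector_derivative (-1)) (at (0 :: real))"
        by (auto intro!: derivative_eq_intros)
      then show ?thesis
        using vector_diff_chain_at[of uminus "-1" 0 "\<lambda>h. ?T h (internal B \<psi>')" \<eta>'] \<eta>'(2)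
        by (simp add: o_def)
    qed
    then have "(f has_vector_derivative inner (c *\<^sub>C \<psi>) (\<i> *\<^sub>C ((-1) *\<^sub>R \<eta>'))) (at 0)"
      unfolding eq
      by (intro bounded_linear.has_vector_derivative[OF
            bounded_linear_compose[OF bounded_linear_inner_right bounded_linear_cscale]])
    then show ?thesis by (simp add: cscale_minus_right)
  qed
  ultimately have "inner ((- \<i> * c) *\<^sub>C \<eta>) \<psi>' = - inner (c *\<^sub>C \<psi>) (\<i> *\<^sub>C \<eta>')"
    by (rule vector_derivative_unique_at)
  then show "inner (c *\<^sub>C \<phi>) \<psi>' = inner (c *\<^sub>C \<psi>) \<phi>'"
    by (simp add: \<eta> \<eta>' cscale_cscale cscale_minus_left cscale_minus_right mult.commute)
qed

lemma symmetric_operator_sum: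
  assumes "\<And>i. i \<in> I \<Longrightarrow> symmetric_operator (H i)"
  shows "symmetric_operator (operator_sum I H)"
  unfolding symmetric_operator_def
proof (intro conjI allI impI)
  have ex: "\<exists>\<phi>'. \<phi> = (\<Sum>i\<in>I. \<phi>' i) \<and> (\<forall>i\<in>I. (\<psi>, \<phi>' i) \<in> H i)"
    if "(\<psi>, \<phi>) \<in> operator_sum I H" for \<psi> \<phi>
    using that by (auto simp: operator_sum_def)
  show "single_valued (operator_sum I H)"
  proof (rule single_valuedI)
    fix \<psi> \<phi> \<phi>'
    assume "(\<psi>, \<phi>) \<in> operator_sum I H" "(\<psi>, \<phi>') \<in> operator_sum I H"
    from this[THEN ex] obtain \<eta> \<eta>' where \<eta>: "\<phi> = (\<Sum>i\<in>I. \<eta> i)" "\<forall>i\<in>I. (\<psi>, \<eta> i) \<in> H i"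
      and \<eta>': "\<phi>' = (\<Sum>i\<in>I. \<eta>' i)" "\<forall>i\<in>I. (\<psi>, \<eta>' i) \<in> H i"
      by blast
    have "\<eta> i = \<eta>' i" if "i \<in> I" for i
    proof -
      have "single_valued (H i)"
        using assms[OF that] unfolding symmetric_operator_def by blast
      then show ?thesis
        by (rule single_valuedD) (use \<eta> \<eta>' that in blast)+
    qed
    then show "\<phi> = \<phi>'"
      unfolding \<eta>(1) \<eta>'(1) by (rule sum.cong[OF refl])
  qed
  fix \<psi> \<phi> \<psi>' \<phi>'
  assume "(\<psi>, \<phi>) \<in> operator_sum I H" "(\<psi>', \<phi>') \<in> operator_sum I H"
  from this[THEN ex] obtain \<eta> \<eta>' where \<eta>: "\<phi> = (\<Sum>i\<in>I. \<eta> i)" "\<forall>i\<in>I. (\<psi>, \<eta> i) \<in> H i"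
    and \<eta>': "\<phi>' = (\<Sum>i\<in>I. \<eta>' i)" "\<forall>i\<in>I. (\<psi>', \<eta>' i) \<in> H i"
    by blast
  have "\<phi> - \<phi>' = (\<Sum>i\<in>I. \<eta> i - \<eta>' i)"
    by (simp add: \<eta>(1) \<eta>'(1) sum_subtractf)
  moreover have "\<forall>i\<in>I. (\<psi> - \<psi>', \<eta> i - \<eta>' i) \<in> H i"
    by (intro ballI symmetric_operatorD(1)[OF assms]) (use \<eta>(2) \<eta>'(2) in blast)+
  ultimately show "(\<psi> - \<psi>', \<phi> - \<phi>') \<in> operator_sum I H"
    unfolding operator_sum_def by blast
  show "inner (c *\<^sub>C \<phi>) \<psi>' = inner (c *\<^sub>C \<psi>) \<phi>'" for c
    unfolding \<eta>(1) \<eta>'(1) cscale_sum_right inner_sum_left inner_sum_right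
  proof (rule sum.cong[OF refl])
    fix i assume "i \<in> I"
    then show "inner (c *\<^sub>C \<eta> i) \<psi>' = inner (c *\<^sub>C \<psi>) (\<eta>' i)"
      using symmetric_operatorD(2)[OF assms] \<eta>(2) \<eta>'(2) by blast
  qed
qed

lemma norm_solution_diff:
  assumes A: "symmetric_operator A" and u: "schroedinger_solution A u" and v: "schroedinger_solution A v"
  shows "norm (u t - v t) = norm (u 0 - v 0)"
proof -
  have "\<exists>\<phi>. \<forall>s. (w s, \<phi> s) \<in> A \<and> (w has_vector_derivative (- \<i> *\<^sub>C \<phi> s)) (at s)"
    if "schroedinger_solution A w" for w
    using that unfolding schroedinger_solution_def by (rule choice)
  from u[THEN this] v[THEN this] obtain \<phi> \<eta> where
      \<phi>: "\<And>s. (u s, \<phi> s) \<in> A" "\<And>s. (u has_vector_derivative (- \<i> *\<^sub>C \<phi> s)) (at s)"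
    and \<eta>: "\<And>s. (v s, \<eta> s) \<in> A" "\<And>s. (v has_vector_derivative (- \<i> *\<^sub>C \<eta> s)) (at s)"
    by blast
  show ?thesis
  proof (rule norm_constant_if_derivative_orthogonal[where w = "\<lambda>t. u t - v t"])
    fix s
    show "((\<lambda>t. u t - v t) has_vector_derivative - \<i> *\<^sub>C (\<phi> s - \<eta> s)) (at s)"
      unfolding cscale_diff_right by (intro has_vector_derivative_diff \<phi> \<eta>)
    show "inner (- \<i> *\<^sub>C (\<phi> s - \<eta> s)) (u s - v s) = 0"
      by (intro symmetric_operator_skew[OF A] symmetric_operatorD(1)[OF A] \<phi> \<eta>)
  qed
qed

text \<open>Any two solutions keep their distance. For fixed \<open>u\<close> this is a closed
  condition on pairs, so it survives the closure of the graph, and at the initial value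
  \<open>u 0\<close> it forces the final value \<open>u t\<close>.\<close>

lemma evolution_eq_solution:
  assumes A: "symmetric_operator A" and u: "schroedinger_solution A u"
  shows "evolution A t (u 0) = u t"
  unfolding evolution_def
proof (rule the_equality)
  let ?G = "{(u 0, u t) | u. schroedinger_solution A u}"
  show "(u 0, u t) \<in> closure ?G"
    by (rule subsetD[OF closure_subset]) (use u in blast)
  fix \<phi>
  assume "(u 0, \<phi>) \<in> closure ?G"
  moreover have "closure ?G \<subseteq> {z. norm (snd z - u t) = norm (fst z - u 0)}"
  proof (rule closure_minimal)
    show "?G \<subseteq> {z. norm (snd z - u t) = norm (fst z - u 0)}"
    proof
      fix z assume "z \<in> ?G"
      then obtain v where v: "z = (v 0, v t)" "schroedinger_solution A v" by blast
      show "z \<in> {z. norm (snd z - u t) = norm (fst z - u 0)}"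
        using norm_solution_diff[OF A v(2) u, of t] by (simp add: v(1))
    qed
    show "closed {z. norm (snd z - u t) = norm (fst z - u 0)}"
      by (intro closed_Collect_eq continuous_intros)
  qed
  ultimately show "\<phi> = u t" by auto
qed

text \<open>A total function extracted from the graph. Outside the domain of \<open>A\<close> its
  value is arbitrary, so it is evaluated only at vectors shown to lie in the domain.\<close>

definition generator :: "('d::finite, 'c::finite) operator \<Rightarrow> ('d, 'c) l2 \<Rightarrow> ('d, 'c) l2" where
  "generator A \<psi> = - \<i> *\<^sub>C (THE \<phi>. (\<psi>, \<phi>) \<in> A)"

lemma generator_eq:
  assumes "symmetric_operator A" "(\<psi>, \<phi>) \<in> A"
  shows "generator A \<psi> = - \<i> *\<^sub>C \<phi>"
proof -
  have "(THE \<phi>. (\<psi>, \<phi>) \<in> A) = \<phi>"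
    using assms by (intro the_equality) (auto simp: symmetric_operator_def dest: single_valuedD)
  then show ?thesis by (simp add: generator_def)
qed

text \<open>
  The ratios \<open>a (k + 1) / a k\<close> increase, so a first ratio above \<open>M\<close> contradicts the growth bound.
\<close>

lemma le_of_log_convex:
  fixes a :: "nat \<Rightarrow> real"
  assumes "\<And>k. 0 \<le> a k" "\<And>k. (a (Suc k))\<^sup>2 \<le> a k * a (Suc (Suc k))"
    and "\<And>k. a k \<le> M ^ k * C" "0 \<le> M"
  shows "a 1 \<le> M * a 0"
proof (rule ccontr)
  assume neg: "\<not> a 1 \<le> M * a 0"
  have pos0: "0 < a 0"
  proof (rule ccontr)
    assume "\<not> 0 < a 0"
    then have "a 0 = 0" using assms(1)[of 0] by simp
    with assms(2)[of 0] neg show False by simp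
  qed
  define r where "r = a 1 / a 0"
  have r: "M < r" using neg pos0 by (simp add: r_def field_simps)
  then have r_pos: "0 < r" using assms(4) by simp
  have step: "0 < a k \<and> r * a k \<le> a (Suc k)" for k
  proof (induction k)
    case 0
    show ?case using pos0 by (simp add: r_def)
  next
    case (Suc k)
    then have pos: "0 < a (Suc k)"
      using mult_pos_pos[OF r_pos, of "a k"] by linarith
    have "(r * a (Suc k)) * a k = (r * a k) * a (Suc k)" by simp
    also have "\<dots> \<le> a (Suc k) * a (Suc k)"
      using Suc pos by (intro mult_right_mono) auto
    also have "\<dots> \<le> a (Suc (Suc k)) * a k"
      using assms(2)[of k] by (simp add: power2_eq_square mult.commute)
    finally have "r * a (Suc k) \<le> a (Suc (Suc k))"
      using Suc by (simp add: mult_le_cancel_right)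
    with pos show ?case by simp
  qed
  have lower: "r ^ k * a 0 \<le> a k" for k
  proof (induction k)
    case (Suc k)
    have "r ^ Suc k * a 0 \<le> r * a k"
      using mult_left_mono[OF Suc, of r] r_pos by (simp add: mult.assoc)
    with step[of k] show ?case by linarith
  qed simp
  show False
  proof (cases "M = 0")
    \<comment> \<open>Division by \<open>M\<close> is impossible here, but the growth bound at
      exponent 1 already gives \<open>a 1 \<le> 0\<close>.\<close>
    case True
    then show ?thesis using lower[of 1] assms(3)[of 1] mult_pos_pos[OF r_pos pos0] by simp
  next
    case False
    then have M: "0 < M" using assms(4) by simp
    then have "1 < r / M" using r by simp
    then obtain n where n: "C / a 0 < (r / M) ^ n"
      using real_arch_pow by blast
    have "r ^ n * a 0 \<le> M ^ n * C" using lower[of n] assms(3)[of n] by linarith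
    then have "(r / M) ^ n * a 0 \<le> C" using M by (simp add: power_divide field_simps)
    then have "(r / M) ^ n \<le> C / a 0" using pos0 by (simp add: field_simps)
    with n show ?thesis by simp
  qed
qed

section \<open>Fourier multipliers and their flows\<close>

lemma measurable_matrix_vector:
  fixes S :: "'a::euclidean_space \<Rightarrow> complex ^ 'c ^ 'c"
  assumes "continuous_on UNIV S" "g \<in> borel_measurable borel"
  shows "(\<lambda>p. S p *v g p) \<in> borel_measurable borel"
proof (rule borel_measurable_continuous_Pair[where H = "\<lambda>A v. A *v v"])
  show "S \<in> borel_measurable borel"
    by (rule borel_measurable_continuous_onI) fact
  show "continuous_on UNIV (\<lambda>x :: (complex ^ 'c ^ 'c) \<times> (complex ^ 'c). fst x *v snd x)"
    unfolding matrix_vector_mult_def by (intro continuous_intros)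
qed fact

text \<open>
  An operator has symbol \<open>S\<close> if it multiplies the Fourier transform by \<open>S p\<close>, and \<open>symbol_gen\<close> is
  the resulting generator \<open>- \<i> A\<close> in momentum space.
\<close>

definition symbol_gen :: "('p \<Rightarrow> complex ^ 'c ^ 'c) \<Rightarrow> 'p \<Rightarrow> complex ^ 'c \<Rightarrow> complex ^ 'c" where
  "symbol_gen S p v = - \<i> *s (S p *v v)"

text \<open>\<open>symbol_graph\<close> places the cutoff states in the domain of \<open>A\<close>
  and gives its action there, and \<open>symmetric\<close> is the global property that makes
  propagators unique. The bound \<open>\<beta> * \<Lambda>\<close> with
  \<open>1 \<le> \<Lambda>\<close> covers symbols affine in the momentum, and the whole package is
  stable under finite sums.\<close>

locale has_symbol =
  fixes A :: "('d::finite, 'c::finite) operator" and S :: "real ^ 'd \<Rightarrow> complex ^ 'c ^ 'c" and \<beta> :: real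
  assumes symmetric: "symmetric_operator A"
    and bound_nonneg: "0 \<le> \<beta>"
    and symbol_hermitian: "hermitian (S p)"
    and symbol_continuous: "continuous_on UNIV S"
    and symbol_bound: "1 \<le> \<Lambda> \<Longrightarrow> (\<And>b. \<bar>p $ b\<bar> \<le> \<Lambda>) \<Longrightarrow> norm (S p *v v) \<le> \<beta> * \<Lambda> * norm v"
    and symbol_graph: "1 \<le> \<Lambda> \<Longrightarrow> g \<in> band \<Lambda> \<Longrightarrow>
        (inv_fourier g, inv_fourier (\<lambda>p. S p *v g p)) \<in> A"
begin

abbreviation G :: "real ^ 'd \<Rightarrow> complex ^ 'c \<Rightarrow> complex ^ 'c" where
  "G \<equiv> symbol_gen S"

lemma linear_gen: "linear (G p)"
  unfolding symbol_gen_def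
  by (intro bounded_linear.linear bounded_linear_compose[OF bounded_linear_vec_complex_scale
        bounded_linear_complex_matrix])

lemma gen_pointwise_skew: "G p v \<bullet> v = 0"
proof -
  have "G p v \<bullet> v = (S p *v v) \<bullet> (\<i> *s v)"
    by (simp add: symbol_gen_def inner_vec_scale)
  also have "\<dots> = v \<bullet> (\<i> *s (S p *v v))"
    by (simp add: inner_hermitian[OF symbol_hermitian] complex_matrix_vec_scale)
  also have "\<dots> = - (G p v \<bullet> v)"
    by (simp add: symbol_gen_def inner_commute vector_sneg_minus1[symmetric])
  finally show ?thesis by simp
qed

lemma norm_gen: "norm (G p v) = norm (S p *v v)"
  by (simp add: symbol_gen_def norm_vec_scale)

lemma pointwise_flow:
  assumes "1 \<le> \<Lambda>" "\<And>b. \<bar>p $ b\<bar> \<le> \<Lambda>"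
  shows "bounded_flow UNIV (G p) (exp_series (G p)) (\<beta> * \<Lambda>)"
  using assms bound_nonneg
  by (intro bounded_flow_exp_series linear_gen gen_pointwise_skew)
    (auto simp: norm_gen intro: symbol_bound)

lemma norm_exp_gen: "norm (exp_series (G p) s v) = norm v"
proof -
  \<comment> \<open>Every single momentum lies in some admissible cube; \<open>1 + norm p\<close> is
    a half-side that is also at least 1.\<close>
  have "\<bar>p $ b\<bar> \<le> 1 + norm p" for b
    using component_le_norm_cart[of p b] by simp
  then show ?thesis
    by (intro bounded_flow.norm_flow[OF pointwise_flow[of "1 + norm p"]]) auto
qed

lemma norm_gen_band:
  assumes "1 \<le> \<Lambda>" "g \<in> band \<Lambda>"
  shows "norm (G p (g p)) \<le> \<beta> * \<Lambda> * norm (g p)"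
proof (cases "\<exists>b. \<bar>p $ b\<bar> > \<Lambda>")
  case True
  then have "g p = 0" using assms(2) unfolding band_def by blast
  then show ?thesis by (simp add: linear_0[OF linear_gen])
next
  case False
  then show ?thesis
    using symbol_bound[OF assms(1)] by (simp add: norm_gen not_less)
qed

lemma measurable_gen:
  "g \<in> borel_measurable borel \<Longrightarrow> (\<lambda>p. G p (g p)) \<in> borel_measurable borel"
  unfolding symbol_gen_def
  using measurable_matrix_vector[OF symbol_continuous] by measurable

lemma gen_band: "1 \<le> \<Lambda> \<Longrightarrow> g \<in> band \<Lambda> \<Longrightarrow> (\<lambda>p. G p (g p)) \<in> band \<Lambda>"
  by (rule band_boundedI[OF _ _ norm_gen_band]) (auto intro: measurable_gen band_measurable)

lemma symbol_band:
  assumes "1 \<le> \<Lambda>" "g \<in> band \<Lambda>"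
  shows "(\<lambda>p. S p *v g p) \<in> band \<Lambda>"
  using norm_gen_band[OF assms] unfolding norm_gen
  by (intro band_boundedI[OF assms(2)] measurable_matrix_vector[OF symbol_continuous]
      band_measurable[OF assms(2)])

text \<open>The exponential is an isometry at every momentum, so it preserves the support and the
  square-integral. Measurability comes from the partial sums of the series.\<close>

lemma exp_gen_band:
  assumes "g \<in> band \<Lambda>"
  shows "(\<lambda>p. exp_series (G p) s (g p)) \<in> band \<Lambda>"
proof (rule band_boundedI[OF assms, where k = 1])
  have pow: "(\<lambda>p. (G p ^^ k) (g p)) \<in> borel_measurable borel" for k
    by (induction k) (use band_measurable[OF assms] measurable_gen in auto)
  show "(\<lambda>p. exp_series (G p) s (g p)) \<in> borel_measurable borel"
  proof (rule borel_measurable_LIMSEQ_metric)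
    show "(\<lambda>p. \<Sum>k<n. (s ^ k / fact k) *\<^sub>R (G p ^^ k) (g p)) \<in> borel_measurable borel" for n
      using pow by measurable
    fix p :: "real ^ 'd"
    have "\<bar>p $ b\<bar> \<le> 1 + norm p" for b
      using component_le_norm_cart[of p b] by simp
    then have "norm (G p v) \<le> \<beta> * (1 + norm p) * norm v" for v
      unfolding norm_gen by (intro symbol_bound) auto
    from summable_exp_series[OF this] bound_nonneg
    show "(\<lambda>n. \<Sum>k<n. (s ^ k / fact k) *\<^sub>R (G p ^^ k) (g p)) \<longlonglongrightarrow> exp_series (G p) s (g p)"
      unfolding exp_series_def by (intro summable_LIMSEQ) simp
  qed
qed (simp add: norm_exp_gen)

lemma inv_fourier_gen:
  assumes "1 \<le> \<Lambda>" "g \<in> band \<Lambda>"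
  shows "inv_fourier (\<lambda>p. G p (g p)) = - \<i> *\<^sub>C inv_fourier (\<lambda>p. S p *v g p)"
  unfolding symbol_gen_def by (rule inv_fourier_cscale[OF symbol_band[OF assms]])

lemma generator_inv_fourier:
  assumes "1 \<le> \<Lambda>" "g \<in> band \<Lambda>"
  shows "generator A (inv_fourier g) = inv_fourier (\<lambda>p. G p (g p))"
  unfolding inv_fourier_gen[OF assms] by (rule generator_eq[OF symmetric symbol_graph[OF assms]])

text \<open>The symbol is unbounded in the momentum, but inside the cube the flow at
  \<open>p\<close> has generator bound \<open>\<beta> * \<Lambda>\<close>, which makes the Taylor
  remainder uniform; outside the cube \<open>g\<close> vanishes.\<close>

lemma inv_fourier_exp_deriv:
  assumes "1 \<le> \<Lambda>" "g \<in> band \<Lambda>"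
  shows "((\<lambda>s. inv_fourier (\<lambda>p. exp_series (G p) s (g p))) has_vector_derivative
      inv_fourier (\<lambda>p. G p (exp_series (G p) s (g p)))) (at s)"
proof (rule inv_fourier_has_vector_derivative[where C = "(\<beta> * \<Lambda>)\<^sup>2 / 2"])
  show "(\<lambda>p. exp_series (G p) s (g p)) \<in> band \<Lambda>" for s
    by (rule exp_gen_band[OF assms(2)])
  then show "(\<lambda>p. G p (exp_series (G p) s (g p))) \<in> band \<Lambda>"
    by (rule gen_band[OF assms(1)])
  fix p :: "real ^ 'd" and h :: real
  show "norm (exp_series (G p) (s + h) (g p) - exp_series (G p) s (g p)
      - h *\<^sub>R G p (exp_series (G p) s (g p))) \<le> (\<beta> * \<Lambda>)\<^sup>2 / 2 * h\<^sup>2 * norm (g p)"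
  proof (cases "\<exists>b. \<bar>p $ b\<bar> > \<Lambda>")
    case True
    then have "g p = 0" using assms(2) unfolding band_def by blast
    moreover have "exp_series (G p) r 0 = 0" for r
      using norm_exp_gen[of p r 0] by simp
    ultimately show ?thesis by (simp add: linear_0[OF linear_gen])
  next
    case False
    then interpret bounded_flow UNIV "G p" "exp_series (G p)" "\<beta> * \<Lambda>"
      by (intro pointwise_flow assms(1)) (simp add: not_less)
    show ?thesis
      using flow_taylor_1_two_sided[of "exp_series (G p) s (g p)" h]
      by (simp add: flow_flow norm_exp_gen add.commute)
  qed
qed (use assms in simp_all)

lemma evolution_inv_fourier:
  assumes "1 \<le> \<Lambda>" "g \<in> band \<Lambda>"
  shows "evolution A s (inv_fourier g) = inv_fourier (\<lambda>p. exp_series (G p) s (g p))"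
proof -
  let ?u = "\<lambda>s. inv_fourier (\<lambda>p. exp_series (G p) s (g p))"
  have "schroedinger_solution A ?u"
    unfolding schroedinger_solution_def
  proof
    fix s
    have band: "(\<lambda>p. exp_series (G p) s (g p)) \<in> band \<Lambda>"
      by (rule exp_gen_band[OF assms(2)])
    show "\<exists>\<phi>. (?u s, \<phi>) \<in> A \<and> (?u has_vector_derivative - \<i> *\<^sub>C \<phi>) (at s)"
      using symbol_graph[OF assms(1) band] inv_fourier_exp_deriv[OF assms, of s]
      unfolding inv_fourier_gen[OF assms(1) band] by blast
  qed
  then show ?thesis
    using evolution_eq_solution[OF symmetric, of ?u s] by (simp add: exp_series_0)
qed

text \<open>The inequality of Plancherel type bounds \<open>norm (inv_fourier g)\<close> by
  \<open>l2_size g\<close> from one side only, so the pointwise bound on the symbol does not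
  transfer directly. Applied to all iterates, it still gives growth at most
  \<open>(\<beta> * \<Lambda>) ^ k\<close> up to the constant \<open>l2_size g\<close>.
  Log-convexity turns this asymptotic rate into a bound for the first step, in which the constant
  has disappeared.\<close>

lemma generator_bound:
  assumes \<Lambda>: "1 \<le> \<Lambda>" and g: "g \<in> band \<Lambda>"
  shows "norm (generator A (inv_fourier g)) \<le> \<beta> * \<Lambda> * norm (inv_fourier g)"
proof -
  define f where "f k p = (G p ^^ k) (g p)" for k p
  have f_Suc: "f (Suc k) = (\<lambda>p. G p (f k p))" for k by (simp add: f_def fun_eq_iff)
  have f_band: "f k \<in> band \<Lambda>" for k
  proof (induction k)
    case 0
    then show ?case using g by (simp add: f_def)
  next
    case (Suc k)
    then show ?case unfolding f_Suc by (rule gen_band[OF \<Lambda>])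
  qed
  define a where "a k = norm (inv_fourier (f k))" for k
  have M: "0 \<le> \<beta> * \<Lambda>" using \<Lambda> bound_nonneg by simp
  have "a 1 \<le> \<beta> * \<Lambda> * a 0"
  proof (rule le_of_log_convex)
    fix k
    show "0 \<le> a k" by (simp add: a_def)
    have rec: "inv_fourier (f (Suc k)) = - \<i> *\<^sub>C inv_fourier (\<lambda>p. S p *v f k p)" for k
      unfolding f_Suc by (rule inv_fourier_gen[OF \<Lambda> f_band])
    have "(a (Suc k))\<^sup>2 = inner (inv_fourier (f (Suc k))) (inv_fourier (f (Suc k)))"
      by (simp add: a_def power2_norm_eq_inner)
    \<comment> \<open>Skewness moves one generator to the other factor; Cauchy-Schwarz then yields
      the log-convexity.\<close>
    also have "\<dots> = - inner (inv_fourier (f k)) (inv_fourier (f (Suc (Suc k))))"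
      using symmetric_operatorD(3)[OF symmetric symbol_graph[OF \<Lambda> f_band] symbol_graph[OF \<Lambda> f_band]]
      unfolding rec[symmetric] .
    also have "\<dots> \<le> a k * a (Suc (Suc k))"
      unfolding a_def using Cauchy_Schwarz_ineq2[of "inv_fourier (f k)" "inv_fourier (f (Suc (Suc k)))"]
      by linarith
    finally show "(a (Suc k))\<^sup>2 \<le> a k * a (Suc (Suc k))" .
    have "l2_size (f k) \<le> (\<beta> * \<Lambda>) ^ k * l2_size g"
    proof (induction k)
      case (Suc k)
      have "l2_size (f (Suc k)) \<le> \<beta> * \<Lambda> * l2_size (f k)"
        unfolding f_Suc
        by (rule l2_size_le[OF band_square_integrable[OF f_band]
              band_square_integrable[OF gen_band[OF \<Lambda> f_band]] norm_gen_band[OF \<Lambda> f_band] M])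
      also have "\<dots> \<le> \<beta> * \<Lambda> * ((\<beta> * \<Lambda>) ^ k * l2_size g)"
        by (rule mult_left_mono[OF Suc M])
      finally show ?case by (simp add: mult.assoc)
    qed (simp add: f_def)
    then show "a k \<le> (\<beta> * \<Lambda>) ^ k * l2_size g"
      unfolding a_def using norm_inv_fourier_le[OF f_band[of k]] by linarith
  qed (rule M)
  moreover have "f 0 = g" "f 1 = (\<lambda>p. G p (g p))"
    by (simp_all add: f_def fun_eq_iff)
  ultimately show ?thesis
    by (simp add: a_def generator_inv_fourier[OF \<Lambda> g])
qed

lemma bounded_flow_evolution:
  assumes \<Lambda>: "1 \<le> \<Lambda>"
  shows "bounded_flow (cutoff_states \<Lambda>) (generator A) (evolution A) (\<beta> * \<Lambda>)"
proof
  show "subspace (cutoff_states \<Lambda> :: ('d, 'c) l2 set)"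
    by (rule subspace_cutoff_states)
  show "0 \<le> \<beta> * \<Lambda>" using \<Lambda> bound_nonneg by simp
  fix \<psi> :: "('d, 'c) l2"
  assume "\<psi> \<in> cutoff_states \<Lambda>"
  then obtain f where f: "f \<in> band \<Lambda>" "\<psi> = inv_fourier f"
    unfolding cutoff_states_eq by blast
  show "generator A \<psi> \<in> cutoff_states \<Lambda>"
    unfolding cutoff_states_eq f(2) generator_inv_fourier[OF \<Lambda> f(1)]
    by (rule imageI) (rule gen_band[OF \<Lambda> f(1)])
  show "generator A (r *\<^sub>R \<psi>) = r *\<^sub>R generator A \<psi>" for r
    unfolding f(2) generator_inv_fourier[OF \<Lambda> f(1)] inv_fourier_scaleR[OF f(1), symmetric]
      inv_fourier_scaleR[OF gen_band[OF \<Lambda> f(1)], symmetric]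
      generator_inv_fourier[OF \<Lambda> band_scaleR[OF f(1)]]
    by (simp add: linear_cmul[OF linear_gen])
  show "norm (generator A \<psi>) \<le> \<beta> * \<Lambda> * norm \<psi>"
    unfolding f(2) by (rule generator_bound[OF \<Lambda> f(1)])
  show "inner (generator A \<psi>) \<psi> = 0"
    unfolding f(2) generator_eq[OF symmetric symbol_graph[OF \<Lambda> f(1)]]
    by (rule symmetric_operator_skew[OF symmetric symbol_graph[OF \<Lambda> f(1)]])
  show "evolution A s \<psi> \<in> cutoff_states \<Lambda>" for s
    unfolding cutoff_states_eq f(2) evolution_inv_fourier[OF \<Lambda> f(1)]
    by (rule imageI) (rule exp_gen_band[OF f(1)])
  show "evolution A 0 \<psi> = \<psi>"
    unfolding f(2) evolution_inv_fourier[OF \<Lambda> f(1)] exp_series_0 ..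
  show "((\<lambda>s. evolution A s \<psi>) has_vector_derivative generator A (evolution A s \<psi>)) (at s)" for s
    unfolding f(2) evolution_inv_fourier[OF \<Lambda> f(1)] generator_inv_fourier[OF \<Lambda> exp_gen_band[OF f(1)]]
    by (rule inv_fourier_exp_deriv[OF \<Lambda> f(1)])
  fix \<phi> :: "('d, 'c) l2"
  assume "\<phi> \<in> cutoff_states \<Lambda>"
  then obtain g where g: "g \<in> band \<Lambda>" "\<phi> = inv_fourier g"
    unfolding cutoff_states_eq by blast
  show "generator A (\<psi> + \<phi>) = generator A \<psi> + generator A \<phi>"
    unfolding f(2) g(2) generator_inv_fourier[OF \<Lambda> f(1)] generator_inv_fourier[OF \<Lambda> g(1)]
      inv_fourier_add[OF f(1) g(1), symmetric] generator_inv_fourier[OF \<Lambda> band_add[OF f(1) g(1)]]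
      inv_fourier_add[OF gen_band[OF \<Lambda> f(1)] gen_band[OF \<Lambda> g(1)], symmetric]
    by (simp add: linear_add[OF linear_gen])
qed

end

section \<open>The product formula\<close>

lemma matrix_vector_bound:
  fixes B :: "complex ^ 'c ^ 'c"
  obtains k where "0 \<le> k" "\<And>v. norm (B *v v) \<le> k * norm v"
  using bounded_linear.nonneg_bounded[OF bounded_linear_complex_matrix[of B]]
  by (metis mult.commute)

lemma has_symbol_constant_term:
  assumes "hermitian B"
  shows "\<exists>S \<beta>. has_symbol (constant_term B :: ('d::finite, 'c::finite) operator) S \<beta>"
proof -
  obtain k where k: "0 \<le> k" "\<And>v. norm (B *v v) \<le> k * norm v"
    using matrix_vector_bound[of B] by blast
  have "has_symbol (constant_term B :: ('d, 'c) operator) (\<lambda>p. B) k"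
  proof
    fix \<Lambda> :: real and v :: "complex ^ 'c" assume "1 \<le> \<Lambda>"
    then have "k * norm v \<le> k * \<Lambda> * norm v"
      using k(1) mult_left_mono[of 1 \<Lambda> k] by (intro mult_right_mono) simp_all
    with k(2)[of v] show "norm (B *v v) \<le> k * \<Lambda> * norm v" by linarith
  next
    fix \<Lambda> :: real and g :: "real ^ 'd \<Rightarrow> complex ^ 'c" assume "g \<in> band \<Lambda>"
    then show "(inv_fourier g, inv_fourier (\<lambda>p. B *v g p)) \<in> constant_term B"
      by (simp add: constant_term_def inv_fourier_internal)
  qed (use assms k in \<open>auto simp: symmetric_constant_term\<close>)
  then show ?thesis by blast
qed

text \<open>A translation by \<open>h\<close> along the axis \<open>b\<close> multiplies
  \<open>g p\<close> by a phase of angle \<open>h * p $ b\<close>. The second order remainder of the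
  phase is at most half the square of the angle, and on the cube
  \<open>\<bar>p $ b\<bar> \<le> \<Lambda>\<close> makes this uniform.\<close>

lemma momentum_inv_fourier:
  fixes g :: "real ^ 'd \<Rightarrow> complex ^ 'c"
  assumes g: "g \<in> band \<Lambda>" and \<Lambda>: "0 \<le> \<Lambda>"
  shows "(inv_fourier g, inv_fourier (\<lambda>p. p $ b *\<^sub>R g p)) \<in> momentum b"
proof -
  have [measurable]: "g \<in> borel_measurable borel" by (rule band_measurable[OF g])
  have [measurable]: "(\<lambda>p :: real ^ 'd. p $ b) \<in> borel_measurable borel"
    by (intro borel_measurable_continuous_onI continuous_intros)
  let ?u = "\<lambda>h p. exp (\<i> * of_real (p \<bullet> (h *\<^sub>R axis b 1))) *s g p"
  let ?u' = "\<lambda>p. (\<i> * of_real (p $ b)) *s g p"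
  have le: "\<bar>p $ b\<bar> * norm (g p) \<le> \<Lambda> * norm (g p)" for p
  proof (cases "\<bar>p $ b\<bar> \<le> \<Lambda>")
    case True
    then show ?thesis by (rule mult_right_mono) simp
  next
    case False
    then have "g p = 0" using band_eq_0[OF g, of p b] by simp
    then show ?thesis by simp
  qed
  have u'_band: "?u' \<in> band \<Lambda>"
    by (rule band_boundedI[OF g _ ], measurable) (use le in \<open>simp add: norm_vec_scale norm_mult\<close>)
  have "((\<lambda>h. inv_fourier (?u h)) has_vector_derivative inv_fourier ?u') (at 0)"
  proof (rule inv_fourier_has_vector_derivative[OF _ u'_band g, where C = "\<Lambda>\<^sup>2 / 2"])
    show "?u h \<in> band \<Lambda>" for h
      by (rule band_boundedI[OF g _ , where k = 1], measurable) (simp add: norm_vec_scale)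
    fix p :: "real ^ 'd" and h :: real
    have inner: "p \<bullet> (r *\<^sub>R axis b 1) = r * p $ b" for r
      by (simp add: inner_axis)
    define \<theta> where "\<theta> = h * p $ b"
    have "norm (?u (0 + h) p - ?u 0 p - h *\<^sub>R ?u' p) = norm ((exp (\<i> * of_real \<theta>) - 1 - \<i> * of_real \<theta>) *s g p)"
      unfolding inner
      by (rule arg_cong[where f = norm])
        (simp add: \<theta>_def vec_eq_iff algebra_simps scaleR_conv_of_real[where 'a = complex])
    also have "\<dots> \<le> (\<bar>\<theta>\<bar>\<^sup>2 / 2) * norm (g p)"
      unfolding norm_vec_scale
      using iexp_approx1[of \<theta> 1] by (intro mult_right_mono) (simp_all add: numeral_2_eq_2 algebra_simps)
    also have "\<dots> = h\<^sup>2 / 2 * (\<bar>p $ b\<bar> * (\<bar>p $ b\<bar> * norm (g p)))"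
      by (simp add: \<theta>_def power2_eq_square abs_mult)
    also have "\<dots> \<le> h\<^sup>2 / 2 * (\<Lambda> * (\<Lambda> * norm (g p)))"
    proof (rule mult_left_mono)
      have "\<bar>p $ b\<bar> * (\<bar>p $ b\<bar> * norm (g p)) \<le> \<Lambda> * (\<bar>p $ b\<bar> * norm (g p))"
        using mult_left_mono[OF le[of p], of "\<bar>p $ b\<bar>"] by (simp add: mult.left_commute)
      also have "\<dots> \<le> \<Lambda> * (\<Lambda> * norm (g p))"
        by (rule mult_left_mono[OF le \<Lambda>])
      finally show "\<bar>p $ b\<bar> * (\<bar>p $ b\<bar> * norm (g p)) \<le> \<Lambda> * (\<Lambda> * norm (g p))" .
    qed simp
    finally show "norm (?u (0 + h) p - ?u 0 p - h *\<^sub>R ?u' p) \<le> \<Lambda>\<^sup>2 / 2 * h\<^sup>2 * norm (g p)"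
      by (simp add: power2_eq_square mult_ac)
  qed simp
  moreover have "inv_fourier (\<lambda>p. p $ b *\<^sub>R g p) = - \<i> *\<^sub>C inv_fourier ?u'"
    unfolding inv_fourier_cscale[OF u'_band, symmetric]
    by (simp add: vector_smult_assoc vec_scale_of_real[symmetric])
  ultimately show ?thesis
    unfolding momentum_def inv_fourier_translate[OF g, symmetric] by blast
qed

lemma has_symbol_linear_term:
  fixes b :: "'d::finite"
  assumes "hermitian B"
  shows "\<exists>S \<beta>. has_symbol (linear_term B b :: ('d, 'c::finite) operator) S \<beta>"
proof -
  obtain k where k: "0 \<le> k" "\<And>v. norm (B *v v) \<le> k * norm v"
    using matrix_vector_bound[of B] by blast
  have scale: "(r *\<^sub>R B) *v v = r *\<^sub>R (B *v v)" for r v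
    by (rule vec_eq_iff[THEN iffD2], rule allI)
      (simp only: matrix_vector_mult_def vec_lambda_beta vector_scaleR_component scaleR_sum_right
        mult_scaleR_left)
  have "has_symbol (linear_term B b :: ('d, 'c) operator) (\<lambda>p. p $ b *\<^sub>R B) k"
  proof
    show "hermitian (p $ b *\<^sub>R B)" for p
      unfolding hermitian_def
    proof (intro allI)
      fix i j
      have "B $ i $ j = cnj (B $ j $ i)"
        using assms unfolding hermitian_def by blast
      then show "(p $ b *\<^sub>R B) $ i $ j = cnj ((p $ b *\<^sub>R B) $ j $ i)"
        by (simp add: scaleR_conv_of_real[where 'a = complex])
    qed
    show "continuous_on UNIV (\<lambda>p :: real ^ 'd. p $ b *\<^sub>R B)"
      by (intro continuous_intros)
  next
    fix \<Lambda> :: real and v :: "complex ^ 'c" and p :: "real ^ 'd"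
    assume "1 \<le> \<Lambda>" "\<And>b. \<bar>p $ b\<bar> \<le> \<Lambda>"
    then have "\<bar>p $ b\<bar> * norm (B *v v) \<le> \<Lambda> * (k * norm v)"
      using k(2)[of v] by (intro mult_mono) auto
    then show "norm ((p $ b *\<^sub>R B) *v v) \<le> k * \<Lambda> * norm v"
      by (simp add: scale mult_ac)
  next
    fix \<Lambda> :: real and g :: "real ^ 'd \<Rightarrow> complex ^ 'c"
    assume \<Lambda>: "1 \<le> \<Lambda>" and g: "g \<in> band \<Lambda>"
    have "(inv_fourier (\<lambda>p. B *v g p), inv_fourier (\<lambda>p. p $ b *\<^sub>R (B *v g p))) \<in> momentum b"
      by (rule momentum_inv_fourier[OF band_linear[OF g bounded_linear_complex_matrix]]) (use \<Lambda> in simp)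
    then show "(inv_fourier g, inv_fourier (\<lambda>p. (p $ b *\<^sub>R B) *v g p)) \<in> linear_term B b"
      unfolding linear_term_def mem_Collect_eq prod.case scale inv_fourier_internal[OF g] .
  qed (use assms k in \<open>auto simp: symmetric_linear_term\<close>)
  then show ?thesis by blast
qed

lemma inv_fourier_sum:
  assumes "finite I" "\<And>i. i \<in> I \<Longrightarrow> f i \<in> band \<Lambda>"
  shows "(\<lambda>p. \<Sum>i\<in>I. f i p) \<in> band \<Lambda> \<and> inv_fourier (\<lambda>p. \<Sum>i\<in>I. f i p) = (\<Sum>i\<in>I. inv_fourier (f i))"
  using assms
proof (induction I rule: finite_induct)
  case empty
  show ?case by (simp add: band_zero inv_fourier_zero)
next
  case (insert x I)
  then have x: "f x \<in> band \<Lambda>" and IH: "(\<lambda>p. \<Sum>i\<in>I. f i p) \<in> band \<Lambda>"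
      "inv_fourier (\<lambda>p. \<Sum>i\<in>I. f i p) = (\<Sum>i\<in>I. inv_fourier (f i))"
    by auto
  show ?case
    using insert(1,2) band_add[OF x IH(1)] inv_fourier_add[OF x IH(1)] IH(2) by simp
qed

lemma matrix_vector_sum:
  fixes S :: "'i \<Rightarrow> complex ^ 'c ^ 'c"
  shows "(\<Sum>i\<in>I. S i) *v v = (\<Sum>i\<in>I. S i *v v)"
proof (induction I rule: infinite_finite_induct)
  case (insert x I)
  then show ?case by (simp add: matrix_vector_mult_add_rdistrib)
qed (simp_all add: vec_eq_iff matrix_vector_mult_def)

lemma has_symbol_sum:
  assumes I: "finite I" and H: "\<And>i. i \<in> I \<Longrightarrow> has_symbol (H i) (S i) (\<beta> i)"
  shows "has_symbol (operator_sum I H) (\<lambda>p. \<Sum>i\<in>I. S i p) (\<Sum>i\<in>I. \<beta> i)"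
proof
  show "symmetric_operator (operator_sum I H)"
    by (intro symmetric_operator_sum has_symbol.symmetric[OF H])
  show "0 \<le> (\<Sum>i\<in>I. \<beta> i)"
    by (intro sum_nonneg has_symbol.bound_nonneg[OF H])
  show "hermitian (\<Sum>i\<in>I. S i p)" for p
  proof -
    have "S i p $ k $ l = cnj (S i p $ l $ k)" if "i \<in> I" for i k l
      using has_symbol.symbol_hermitian[OF H[OF that], of p] unfolding hermitian_def by blast
    then show ?thesis
      unfolding hermitian_def sum_component cnj_sum by (intro allI sum.cong refl) blast
  qed
  show "continuous_on UNIV (\<lambda>p. \<Sum>i\<in>I. S i p)"
    by (intro continuous_on_sum has_symbol.symbol_continuous[OF H])
  show "norm ((\<Sum>i\<in>I. S i p) *v v) \<le> (\<Sum>i\<in>I. \<beta> i) * \<Lambda> * norm v"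
    if "1 \<le> \<Lambda>" "\<And>b. \<bar>p $ b\<bar> \<le> \<Lambda>" for \<Lambda> p v
    unfolding matrix_vector_sum sum_distrib_right
    by (intro sum_norm_le has_symbol.symbol_bound[OF H] that)
  show "(inv_fourier g, inv_fourier (\<lambda>p. (\<Sum>i\<in>I. S i p) *v g p)) \<in> operator_sum I H"
    if "1 \<le> \<Lambda>" "g \<in> band \<Lambda>" for \<Lambda> g
  proof -
    have "inv_fourier (\<lambda>p. (\<Sum>i\<in>I. S i p) *v g p) = (\<Sum>i\<in>I. inv_fourier (\<lambda>p. S i p *v g p))"
      unfolding matrix_vector_sum
      by (rule conjunct2[OF inv_fourier_sum[OF I]]) (rule has_symbol.symbol_band[OF H that])
    moreover have "\<forall>i\<in>I. (inv_fourier g, inv_fourier (\<lambda>p. S i p *v g p)) \<in> H i"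
      using has_symbol.symbol_graph[OF H that] by blast
    ultimately show ?thesis
      unfolding operator_sum_def by blast
  qed
qed

lemma generator_sum_insert:
  assumes "symmetric_operator (H x)" "symmetric_operator (operator_sum I H)"
      "symmetric_operator (operator_sum (insert x I) H)"
    and "(\<psi>, \<phi>) \<in> H x" "(\<psi>, \<eta>) \<in> operator_sum I H" "finite I" "x \<notin> I"
  shows "generator (operator_sum (insert x I) H) \<psi>
    = generator (H x) \<psi> + generator (operator_sum I H) \<psi>"
proof -
  obtain \<xi> where \<xi>: "\<eta> = (\<Sum>i\<in>I. \<xi> i)" "\<forall>i\<in>I. (\<psi>, \<xi> i) \<in> H i"
    using assms(5) unfolding operator_sum_def by blast
  \<comment> \<open>An element of the graph of a sum is witnessed by a family of images, so the
    family for \<open>I\<close> is updated at \<open>x\<close>.\<close>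
  define \<zeta> where "\<zeta> = \<xi>(x := \<phi>)"
  have "(\<Sum>i\<in>insert x I. \<zeta> i) = \<phi> + \<eta>"
    using assms(6,7) by (auto simp: \<zeta>_def \<xi>(1) intro!: sum.cong)
  moreover have "\<forall>i\<in>insert x I. (\<psi>, \<zeta> i) \<in> H i"
    using assms(4) \<xi>(2) by (auto simp: \<zeta>_def)
  ultimately have "(\<psi>, \<phi> + \<eta>) \<in> operator_sum (insert x I) H"
    unfolding operator_sum_def by force
  from generator_eq[OF assms(3) this] generator_eq[OF assms(1,4)] generator_eq[OF assms(2,5)]
  show ?thesis by (simp add: cscale_add_right)
qed

lemma bounded_flow_mono:
  assumes "bounded_flow K Z U M" "M \<le> M'"
  shows "bounded_flow K Z U M'"
proof -
  interpret bounded_flow K Z U M by fact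
  show ?thesis
  proof
    show "norm (Z x) \<le> M' * norm x" if "x \<in> K" for x
      using gen_bound[OF that] mult_right_mono[OF assms(2) norm_ge_zero[of x]] by linarith
  qed (use subspace gen_in gen_add gen_scale gen_skew flow_in flow_0 flow_deriv bound_nonneg assms(2)
      in auto)
qed

section \<open>Local and global error of the product formula\<close>

text \<open>\<open>trotter_step\<close> for an arbitrary list of factors, so that induction can
  strip the outermost factor from both ends at once.\<close>

definition palindromic_product :: "('i \<Rightarrow> 'a \<Rightarrow> 'a) \<Rightarrow> 'i list \<Rightarrow> 'a \<Rightarrow> 'a" where
  "palindromic_product E xs =
     foldr (\<circ>) (map E xs) id \<circ> foldr (\<circ>) (map E (rev xs)) id"

lemma foldr_comp_eq: "foldr (\<circ>) fs g = foldr (\<circ>) fs id \<circ> g"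
  by (induction fs) (simp_all add: comp_assoc)

lemma palindromic_product_Cons:
  "palindromic_product E (x # xs) \<psi> = E x (palindromic_product E xs (E x \<psi>))"
  unfolding palindromic_product_def
  by (simp add: foldr_comp_eq[of _ "E x"])

text \<open>Replacing the inner palindrome by the exact propagator of the remaining terms costs the
  error of the induction hypothesis, which the outer isometry leaves unchanged. Merging the outer
  factors with that propagator costs one splitting error. \<open>M\<close> dominates the doubled
  generators of all partial sums, so every layer costs the same. Invariance and isometry are part of
  the induction because the hypothesis is applied to the state already moved by the outer
  factor.\<close>

lemma palindromic_product_error:
  fixes H :: "nat \<Rightarrow> ('d::finite, 'c::finite) operator" and M :: real
  assumes \<Lambda>: "1 \<le> \<Lambda>" and a: "0 \<le> a"
    and H: "\<And>l. l \<in> J \<Longrightarrow> has_symbol (H l) (S l) (\<beta> l)" and J: "finite J"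
    and M: "M = 2 * ((\<Sum>l\<in>J. \<beta> l) * \<Lambda>)"
    and xs: "distinct xs" "set xs \<subseteq> J" and \<psi>: "\<psi> \<in> cutoff_states \<Lambda>"
  shows "palindromic_product (\<lambda>l. evolution (H l) a) xs \<psi> \<in> cutoff_states \<Lambda> \<and>
    norm (palindromic_product (\<lambda>l. evolution (H l) a) xs \<psi>) = norm \<psi> \<and>
    norm (palindromic_product (\<lambda>l. evolution (H l) a) xs \<psi>
        - evolution (operator_sum (set xs) H) (2 * a) \<psi>) \<le> length xs * (5 * (M * a) ^ 3) * norm \<psi>"
  using xs \<psi>
proof (induction xs arbitrary: \<psi>)
  case Nil
  \<comment> \<open>The empty sum has symbol 0 and bound 0, so its propagator is the identity on
    cutoff states and matches the empty product.\<close>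
  interpret bounded_flow "cutoff_states \<Lambda>" "generator (operator_sum {} H)" "evolution (operator_sum {} H)" 0
    using has_symbol.bounded_flow_evolution[OF has_symbol_sum[of "{}" H S \<beta>] \<Lambda>] by simp
  show ?case
    using flow_taylor_0[OF Nil(3), of "2 * a"] a Nil(3) by (simp add: palindromic_product_def)
next
  case (Cons x xs)
  let ?V = "palindromic_product (\<lambda>l. evolution (H l) a) xs"
  have x: "x \<in> J" "x \<notin> set xs" "distinct xs" "set xs \<subseteq> J" using Cons.prems by auto
  note nonneg = has_symbol.bound_nonneg[OF H]
  have sym: "has_symbol (operator_sum I H) (\<lambda>p. \<Sum>i\<in>I. S i p) (\<Sum>i\<in>I. \<beta> i)" if "I \<subseteq> J" for I
    using that by (intro has_symbol_sum H) (auto intro: finite_subset[OF _ J])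
  have le: "2 * ((\<Sum>i\<in>I. \<beta> i) * \<Lambda>) \<le> M" if "I \<subseteq> J" for I
    unfolding M using \<Lambda> sum_mono2[OF J that, of \<beta>] nonneg by (auto intro!: mult_right_mono)
  have flow: "bounded_flow (cutoff_states \<Lambda>) (\<lambda>\<psi>. 2 *\<^sub>R generator (operator_sum I H) \<psi>)
      (\<lambda>s. evolution (operator_sum I H) (2 * s)) M" if "I \<subseteq> J" for I
    by (rule bounded_flow_mono[OF bounded_flow.flow_scaled[OF
            has_symbol.bounded_flow_evolution[OF sym[OF that] \<Lambda>]] le[OF that]]) simp
  have "\<beta> x * \<Lambda> \<le> 2 * ((\<Sum>i\<in>{x}. \<beta> i) * \<Lambda>)"
    using nonneg[OF x(1)] \<Lambda> by simp
  also have "\<dots> \<le> M" by (rule le) (use x in simp)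
  finally have flow_x: "bounded_flow (cutoff_states \<Lambda>) (generator (H x)) (evolution (H x)) M"
    by (rule bounded_flow_mono[OF has_symbol.bounded_flow_evolution[OF H[OF x(1)] \<Lambda>]])
  interpret X: bounded_flow "cutoff_states \<Lambda>" "generator (H x)" "evolution (H x)" M
    by (rule flow_x)
  interpret W: bounded_flow "cutoff_states \<Lambda>" "\<lambda>\<psi>. 2 *\<^sub>R generator (operator_sum (set xs) H) \<psi>"
      "\<lambda>s. evolution (operator_sum (set xs) H) (2 * s)" M
    by (rule flow[OF x(4)])
  define \<phi> where "\<phi> = evolution (H x) a \<psi>"
  have \<phi>: "\<phi> \<in> cutoff_states \<Lambda>" "norm \<phi> = norm \<psi>"
    unfolding \<phi>_def using Cons.prems by (auto intro: X.flow_in X.norm_flow)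
  note IH = Cons.IH[OF x(3,4) \<phi>(1)]
  let ?W = "evolution (operator_sum (set xs) H) (2 * a) \<phi>"
  let ?X = "evolution (operator_sum (set (x # xs)) H) (2 * a) \<psi>"
  have W: "?W \<in> cutoff_states \<Lambda>" using W.flow_in[OF \<phi>(1), of a] by simp
  have gen: "2 *\<^sub>R generator (operator_sum (set (x # xs)) H) \<eta>
      = 2 *\<^sub>R generator (H x) \<eta> + 2 *\<^sub>R generator (operator_sum (set xs) H) \<eta>"
    if \<eta>: "\<eta> \<in> cutoff_states \<Lambda>" for \<eta>
  proof -
    obtain g where g: "g \<in> band \<Lambda>" "\<eta> = inv_fourier g"
      using \<eta> unfolding cutoff_states_eq by blast
    have "generator (operator_sum (insert x (set xs)) H) \<eta>
      = generator (H x) \<eta> + generator (operator_sum (set xs) H) \<eta>"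
      unfolding g(2)
      by (rule generator_sum_insert[OF has_symbol.symmetric[OF H[OF x(1)]]
            has_symbol.symmetric[OF sym[OF x(4)]] has_symbol.symmetric[OF sym]
            has_symbol.symbol_graph[OF H[OF x(1)] \<Lambda> g(1)]
            has_symbol.symbol_graph[OF sym[OF x(4)] \<Lambda> g(1)]]) (use x in auto)
    then show ?thesis by (simp add: scaleR_add_right)
  qed
  \<comment> \<open>The splitting estimate is used with \<open>P\<close> the generator of
    \<open>H x\<close>, with \<open>Q\<close> twice the generator of the remaining sum, and with
    \<open>R\<close> twice the generator of the whole sum.\<close>
  have strang: "norm (evolution (H x) a ?W - ?X) \<le> 5 * (M * a) ^ 3 * norm \<psi>"
    unfolding \<phi>_def
    using strang_splitting_bound[OF flow_x flow[OF x(4)] flow[OF Cons.prems(2)] gen Cons.prems(3) a]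
    by simp
  have "norm (evolution (H x) a (?V \<phi>) - evolution (H x) a ?W) = norm (?V \<phi> - ?W)"
    using X.flow_diff[of "?V \<phi>" ?W a] X.norm_flow[of "?V \<phi> - ?W" a] IH W X.space_closed(2) by simp
  then have "norm (evolution (H x) a (?V \<phi>) - ?X)
      \<le> length xs * (5 * (M * a) ^ 3) * norm \<psi> + 5 * (M * a) ^ 3 * norm \<psi>"
    using norm_triangle_ineq[of "evolution (H x) a (?V \<phi>) - evolution (H x) a ?W" "evolution (H x) a ?W - ?X"]
      strang IH \<phi>(2) by simp
  moreover have "evolution (H x) a (?V \<phi>) \<in> cutoff_states \<Lambda>"
    "norm (evolution (H x) a (?V \<phi>)) = norm \<psi>"
    using IH X.flow_in X.norm_flow \<phi>(2) by auto
  ultimately show ?case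
    unfolding palindromic_product_Cons \<phi>_def[symmetric] by (simp add: algebra_simps)
qed

text \<open>Errors add without amplification: \<open>U r\<close> is an isometry, so it carries the
  old error along unchanged, and \<open>V\<close> preserves the norm, so each new error is measured
  against the same \<open>norm x\<close>.\<close>

lemma (in bounded_flow) power_error:
  assumes "\<And>x. x \<in> K \<Longrightarrow> V x \<in> K" "\<And>x. x \<in> K \<Longrightarrow> norm (V x) = norm x"
    and "\<And>x. x \<in> K \<Longrightarrow> norm (V x - U r x) \<le> \<delta> * norm x" and "x \<in> K"
  shows "(V ^^ k) x \<in> K \<and> norm ((V ^^ k) x) = norm x \<and>
    norm ((V ^^ k) x - U (real k * r) x) \<le> real k * \<delta> * norm x"
proof (induction k)
  case 0
  show ?case using assms(4) by (simp add: flow_0)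
next
  case (Suc k)
  let ?v = "(V ^^ k) x" and ?u = "U (real k * r) x"
  have u: "?u \<in> K" using assms(4) by (rule flow_in)
  have "U (real (Suc k) * r) x = U r ?u"
    using flow_flow[OF assms(4), of r "real k * r"] by (simp add: algebra_simps)
  moreover have "norm (V ?v - U r ?u) \<le> norm (V ?v - U r ?v) + norm (U r ?v - U r ?u)"
    using norm_triangle_ineq[of "V ?v - U r ?v" "U r ?v - U r ?u"] by simp
  moreover have "norm (U r ?v - U r ?u) = norm (?v - ?u)"
    using Suc u flow_diff[of ?v ?u r] norm_flow[of "?v - ?u" r] space_closed(2) by simp
  moreover have "norm (V ?v - U r ?v) \<le> \<delta> * norm x"
    using assms(3)[of ?v] Suc by simp
  ultimately show ?case
    using Suc assms(1,2) by (simp add: algebra_simps)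
qed

theorem theorem3p3:
  fixes H :: "nat \<Rightarrow> ('d::finite, 'c::finite) operator" and n :: nat and t :: real
  assumes "\<forall>l\<in>{1..n}. \<exists>B. hermitian B \<and>
             ((\<exists>b. H l = linear_term B b) \<or> H l = constant_term B)"
  shows "\<exists>C::real. \<forall>\<Lambda> :: real \<Rightarrow> real. filterlim \<Lambda> at_top (at_right 0) \<longrightarrow>
           (\<forall>\<^sub>F a in at_right 0. \<forall>N::nat. even N \<longrightarrow> real N * a = t \<longrightarrow>
              cutoff_norm (\<Lambda> a)
                (\<lambda>\<psi>. (trotter_step n H a ^^ (N div 2)) \<psi> - evolution (operator_sum {1..n} H) t \<psi>)
              \<le> ereal (C * \<Lambda> a ^ 3 * a\<^sup>2))"
proof -
  have "\<forall>l\<in>{1..n}. \<exists>S. \<exists>\<beta>. has_symbol (H l) S \<beta>"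
    using assms has_symbol_constant_term has_symbol_linear_term by metis
  from bchoice[OF this] obtain S where "\<forall>l\<in>{1..n}. \<exists>\<beta>. has_symbol (H l) (S l) \<beta>"
    by blast
  from bchoice[OF this] obtain \<beta> where H: "\<And>l. l \<in> {1..n} \<Longrightarrow> has_symbol (H l) (S l) (\<beta> l)"
    by blast
  define b where "b = (\<Sum>l\<in>{1..n}. \<beta> l)"
  \<comment> \<open>There are \<open>t / (2 * a)\<close> steps with error
    \<open>n * 5 * (2 * b * \<Lambda> * a) ^ 3\<close> each, and 40 / 2 = 20.\<close>
  define C where "C = 20 * n * b ^ 3 * t"
  have *: "cutoff_norm \<Lambda>
      (\<lambda>\<psi>. (trotter_step n H a ^^ (N div 2)) \<psi> - evolution (operator_sum {1..n} H) t \<psi>)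
      \<le> ereal (C * \<Lambda> ^ 3 * a\<^sup>2)"
    if \<Lambda>: "1 \<le> \<Lambda>" and a: "0 < a" and "even N" and t: "real N * a = t" for \<Lambda> a :: real and N :: nat
  proof -
    obtain k where N: "N = 2 * k" using \<open>even N\<close> by blast
    define M where "M = 2 * (b * \<Lambda>)"
    define \<delta> where "\<delta> = n * (5 * (M * a) ^ 3)"
    have step: "trotter_step n H a = palindromic_product (\<lambda>l. evolution (H l) a) [1..<Suc n]"
      by (simp only: trotter_step_def palindromic_product_def)
    have set: "set [1..<Suc n] = {1..n}"
      by (simp only: set_upt atLeastLessThanSuc_atLeastAtMost)
    have err: "trotter_step n H a \<psi> \<in> cutoff_states \<Lambda> \<and> norm (trotter_step n H a \<psi>) = norm \<psi> \<and>
        norm (trotter_step n H a \<psi> - evolution (operator_sum {1..n} H) (2 * a) \<psi>) \<le> \<delta> * norm \<psi>"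
      if "\<psi> \<in> cutoff_states \<Lambda>" for \<psi>
      using palindromic_product_error[OF \<Lambda> less_imp_le[OF a] H finite_atLeastAtMost
          M_def[unfolded b_def] distinct_upt eq_refl[OF set] that]
      unfolding step \<delta>_def set length_upt diff_Suc_1 .
    interpret bounded_flow "cutoff_states \<Lambda>" "generator (operator_sum {1..n} H)"
        "evolution (operator_sum {1..n} H)" "b * \<Lambda>"
      unfolding b_def
      by (rule has_symbol.bounded_flow_evolution[OF has_symbol_sum[OF finite_atLeastAtMost H] \<Lambda>])
    have "norm ((trotter_step n H a ^^ k) \<psi> - evolution (operator_sum {1..n} H) t \<psi>)
        \<le> C * \<Lambda> ^ 3 * a\<^sup>2" if \<psi>: "\<psi> \<in> cutoff_states \<Lambda>" "norm \<psi> \<le> 1" for \<psi>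
    proof -
      have "norm ((trotter_step n H a ^^ k) \<psi> - evolution (operator_sum {1..n} H) (real k * (2 * a)) \<psi>)
          \<le> real k * \<delta> * norm \<psi>"
        using power_error[of "trotter_step n H a" "2 * a" \<delta> \<psi> k] err \<psi>(1) by blast
      also have "\<dots> \<le> real k * \<delta> * 1"
        using \<psi>(2) a \<Lambda> bound_nonneg by (intro mult_left_mono) (simp_all add: \<delta>_def M_def)
      also have "\<dots> = C * \<Lambda> ^ 3 * a\<^sup>2"
        using t by (simp add: \<delta>_def M_def C_def N power2_eq_square power3_eq_cube algebra_simps)
      also have "real k * (2 * a) = t" using t by (simp add: N)
      finally show ?thesis .
    qed
    then show ?thesis
      unfolding cutoff_norm_def by (auto simp: N intro!: SUP_least)
  qed
  have "\<forall>\<^sub>F a in at_right 0. \<forall>N::nat. even N \<longrightarrow> real N * a = t \<longrightarrow>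
      cutoff_norm (\<Lambda> a)
        (\<lambda>\<psi>. (trotter_step n H a ^^ (N div 2)) \<psi> - evolution (operator_sum {1..n} H) t \<psi>)
      \<le> ereal (C * \<Lambda> a ^ 3 * a\<^sup>2)" if "filterlim \<Lambda> at_top (at_right 0)" for \<Lambda>
  proof -
    \<comment> \<open>Divergence of the cutoff supplies \<open>1 \<le> \<Lambda> a\<close> for small
      \<open>a\<close>. The constant was fixed beforehand, so it is the same for every cutoff
      function.\<close>
    have "\<forall>\<^sub>F a in at_right 0. 1 \<le> \<Lambda> a"
      using that unfolding filterlim_at_top by blast
    moreover have "\<forall>\<^sub>F a :: real in at_right 0. 0 < a"
      by (simp add: eventually_at_right_less)
    ultimately show ?thesis
      by eventually_elim (use * in blast)
  qed
  then show ?thesis by blast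
qed

end
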